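(* Let $p\ge1$. For each $1\le i\le p$ let $X_i$ be a locally compact subset of $\mathbb{R}^{d_i}$ equipped with a $\delta_i$-Ahlfors regular measure $\mu_i$, and let $(B_{i,n})_{n\in\mathbb{N}}$ be a sequence of balls $B_{i,n}=B(x_{i,n},r(B_{i,n}))$ in $X_i$ with $r(B_{i,n})\to0$ as $n\to\infty$. Assume there are sequences of positive reals $(r_n)_{n\in\mathbb{N}}$ and $(v_{i,n})_{n\in\mathbb{N}}$ ($1\le i\le p$) such that $r(B_{i,n})=r_n^{v_{i,n}}$ for all $i,n$, $\lim_{n\to\infty}r_n=0$, and $\lim_{n\to\infty}v_{i,n}=v_i$ for some $\mathbf{v}=(v_1,\dots,v_p)\in(\mathbb{R}^+\cup\{+\infty\})^p$. Suppose there exists $\mathbf{u}=(u_1,\dots,u_p)\in(\mathbb{R}^+)^p$ with $u_i\le v_i$ for each $i$ and $$\mu_1\times\cdots\times\mu_p\Big(\limsup_{n\to\infty}\prod_{i=1}^pB_{i,n}^{s_{i,n}}\Big)=\mu_1\times\cdots\times\mu_p\Big(\prod_{i=1}^pX_i\Big),\qquad s_{i,n}:=\frac{u_i\delta_i}{v_{i,n}}.$$ Then $\dim_{\rm H}\big(\limsup_{n\to\infty}\prod_{i=1}^pB_{i,n}\big)\ge s_0(\mathbf{u},\mathbf{v})$.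
   Context: A measure $\mu$ on a locally compact $X\subset\mathbb{R}^d$ is $\delta$-Ahlfors regular if it is a non-atomic probability measure and there are constants $0<a\le1\le b<\infty$, $r_0>0$ with $a r^\delta\le\mu(B(x,r))\le br^\delta$ for all $x\in X$, $r\le r_0$. For a ball $B=B(x,r)$ in $X_i$ and $s>0$, the scaled ball is $B^s:=B(x,r^{s/\delta_i})$; thus $B_{i,n}^{s_{i,n}}=B(x_{i,n},r_n^{u_i})$. Dimensional number: let $\boldsymbol\delta=(\delta_1,\dots,\delta_p)$, $\mathcal{L}(\mathbf{v}):=\{i: v_i<+\infty\}$. For $i\in\mathcal{L}(\mathbf{v})$ put $s(\mathbf{u},\mathbf{v},i):=\sum_{k\in\mathcal{K}_1(i)}\delta_k+\sum_{k\in\mathcal{K}_2(i)}\delta_k\big(1-\frac{v_k-u_k}{v_i}\big)+\sum_{k\in\mathcal{K}_3(i)}\frac{\delta_ku_k}{v_i}$, where $\mathcal{K}_1(i)=\{1\le k\le p:u_k>v_i\}$, $\mathcal{K}_2(i)=\{k\in\mathcal{L}(\mathbf{v}):v_k\le v_i\}$, $\mathcal{K}_3(i)=\{1,\dots,p\}\setminus(\mathcal{K}_1(i)\cup\mathcal{K}_2(i))$; for $i\notin\mathcal{L}(\mathbf{v})$ put $s(\mathbf{u},\mathbf{v},i):=\sum_{k\in\mathcal{L}(\mathbf{v})}\delta_k$. Then $s_0(\mathbf{u},\mathbf{v}):=\min_{1\le i\le p}s(\mathbf{u},\mathbf{v},i)$. *)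

theory Defs
  imports "HOL-Analysis.Analysis" "HOL-Probability.Probability"
begin

(* Contribution of a covering set U to the s-dimensional Hausdorff sum.  The case
   distinction is needed because 0 powr 0 = 0, whereas a nonempty set has to contribute
   diam(U)^0 = 1.  It is only applied to bounded sets, on which diameter is meaningful. *)
definition hausdorff_gauge :: "real \<Rightarrow> 'a::metric_space set \<Rightarrow> ennreal" where
  "hausdorff_gauge s U =
     (if U = {} then 0 else if s = 0 then 1 else ennreal (diameter U powr s))"

definition hausdorff_premeasure :: "real \<Rightarrow> real \<Rightarrow> 'a::metric_space set \<Rightarrow> ennreal" where
  "hausdorff_premeasure \<epsilon> s E =
     (INF U \<in> {U :: nat \<Rightarrow> 'a set. (\<forall>k. bounded (U k) \<and> diameter (U k) \<le> \<epsilon>) \<and> E \<subseteq> (\<Union>k. U k)}.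
        \<Sum>k. hausdorff_gauge s (U k))"

definition hausdorff_measure :: "real \<Rightarrow> 'a::metric_space set \<Rightarrow> ennreal" where
  "hausdorff_measure s E = (SUP \<epsilon> \<in> {0<..}. hausdorff_premeasure \<epsilon> s E)"

definition hausdorff_dim :: "'a::metric_space set \<Rightarrow> ereal" where
  "hausdorff_dim E = (INF s \<in> {s. 0 \<le> s \<and> hausdorff_measure s E = 0}. ereal s)"

definition nonatomic :: "'a measure \<Rightarrow> bool" where
  "nonatomic M \<longleftrightarrow>
     \<not> (\<exists>A\<in>sets M. emeasure M A > 0 \<and>
          (\<forall>B\<in>sets M. B \<subseteq> A \<longrightarrow> emeasure M B = 0 \<or> emeasure M B = emeasure M A))"

definition ball_in :: "'a::metric_space set \<Rightarrow> 'a \<Rightarrow> real \<Rightarrow> 'a set" where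
  "ball_in X x r = ball x r \<inter> X"

(* The ball B = B(x, r) of X is given by its centre and radius, which need not be
   determined by the underlying set; this is B^s, for X of regularity exponent \<delta>. *)
definition scaled_ball :: "'a::metric_space set \<Rightarrow> real \<Rightarrow> real \<Rightarrow> 'a \<Rightarrow> real \<Rightarrow> 'a set" where
  "scaled_ball X \<delta> s x r = ball_in X x (r powr (s / \<delta>))"

(* The condition on the \<sigma>-algebra also gives space \<mu> = X. *)
definition ahlfors_regular :: "real \<Rightarrow> 'a::metric_space set \<Rightarrow> 'a measure \<Rightarrow> bool" where
  "ahlfors_regular \<delta> X \<mu> \<longleftrightarrow>
     sets \<mu> = sets (restrict_space borel X) \<and> prob_space \<mu> \<and> nonatomic \<mu> \<and>
     (\<exists>a b r0. 0 < a \<and> a \<le> 1 \<and> 1 \<le> b \<and> 0 < r0 \<and>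
        (\<forall>x\<in>X. \<forall>r. 0 < r \<and> r \<le> r0 \<longrightarrow>
           a * r powr \<delta> \<le> measure \<mu> (ball_in X x r) \<and>
           measure \<mu> (ball_in X x r) \<le> b * r powr \<delta>))"

definition fin_idx :: "('p \<Rightarrow> ereal) \<Rightarrow> 'p set" where
  "fin_idx v = {i. v i < \<infinity>}"

definition K1 :: "('p \<Rightarrow> real) \<Rightarrow> ('p \<Rightarrow> ereal) \<Rightarrow> 'p \<Rightarrow> 'p set" where
  "K1 u v i = {k. ereal (u k) > v i}"

definition K2 :: "('p \<Rightarrow> ereal) \<Rightarrow> 'p \<Rightarrow> 'p set" where
  "K2 v i = {k \<in> fin_idx v. v k \<le> v i}"

definition K3 :: "('p \<Rightarrow> real) \<Rightarrow> ('p \<Rightarrow> ereal) \<Rightarrow> 'p \<Rightarrow> 'p set" where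
  "K3 u v i = UNIV - (K1 u v i \<union> K2 v i)"

(* real_of_ereal is only applied to v k and v i with k, i in fin_idx v. *)
definition dim_number_at ::
    "('p::finite \<Rightarrow> real) \<Rightarrow> ('p \<Rightarrow> real) \<Rightarrow> ('p \<Rightarrow> ereal) \<Rightarrow> 'p \<Rightarrow> real" where
  "dim_number_at \<delta> u v i =
     (if i \<in> fin_idx v then
        (\<Sum>k\<in>K1 u v i. \<delta> k)
        + (\<Sum>k\<in>K2 v i. \<delta> k * (1 - (real_of_ereal (v k) - u k) / real_of_ereal (v i)))
        + (\<Sum>k\<in>K3 u v i. \<delta> k * u k / real_of_ereal (v i))
      else (\<Sum>k\<in>fin_idx v. \<delta> k))"

definition dim_number ::
    "('p::finite \<Rightarrow> real) \<Rightarrow> ('p \<Rightarrow> real) \<Rightarrow> ('p \<Rightarrow> ereal) \<Rightarrow> real" where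
  "dim_number \<delta> u v = Min (range (dim_number_at \<delta> u v))"

(* Conventions of the main statement.
   The p factors are indexed by a finite type 'p.  The spaces R^(d i), whose dimensions may
   differ, are d i-dimensional linear subspaces V i of one Euclidean space 'a; every finite
   family of Euclidean spaces arises in this way up to isometry.
   The product measure lives on functions 'p => 'a.  The library metric on that function type
   is not the Euclidean product metric, so for Hausdorff dimension the product set is carried
   by vec_lambda to the type ('a, 'p) vec, whose metric is. *)

end

theory Submission
  imports Defs
begin

text \<open>
  A Frostman argument with finitely many steps at a time. Start from the product measure on a small
  compact box. Given a measure with bounded density carried by a relatively open set \<open>G\<close>, select
  finitely many of the big rectangles (sides \<open>r\<^sub>n\<close> to the power \<open>u\<^sub>i\<close>) inside \<open>G\<close>, with \<open>n\<close> large,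
  pairwise disjoint and such that their threefold enlargements carry almost all the mass (full measure
  and Vitali; rectangles of these shapes are nested up to translation), and move the mass of the
  enlargements into the small rectangles at the same centres. At scales that are not tiny the Frostman
  constant for the exponent \<open>t\<close> grows by a factor as close to 1 as desired, since the rectangles may
  be taken as small as desired; at tiny scales a packing estimate gives a bound
  with an exponent \<open>t' > t\<close>, which absorbs every constant. The exponent of the packing estimate at scale
  \<open>r\<^sub>n\<close> to the power \<open>w\<close> is \<open>mass_exponent w / w\<close>, and its infimum over \<open>w\<close> is the dimensional number.
  The supports are nested compact sets, so a cover of the limsup set covers one of them, and no
  limit measure is needed.
\<close>

subsection \<open>The dimensional number as an infimum over all scales\<close>

text \<open>With \<open>\<rho> = r powr w\<close> and \<open>0 < r < 1\<close>, the summand for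
  \<open>k\<close> is the exponent of \<open>r\<close> in \<open>(max \<rho> (r powr u k) * min 1
  (\<rho> / r powr V k)) powr \<delta> k\<close>, which governs one rectangle at scale
  \<open>\<rho>\<close>. Outside \<open>L\<close> the exponent \<open>V k\<close> counts as
  infinite, and the minimum contributes only a constant.\<close>

definition mass_exponent :: "('p::finite \<Rightarrow> real) \<Rightarrow> ('p \<Rightarrow> real) \<Rightarrow> 'p set \<Rightarrow> ('p \<Rightarrow> real) \<Rightarrow> real \<Rightarrow> real" where
  "mass_exponent \<delta> u L V w =
     (\<Sum>k\<in>UNIV. \<delta> k * (min w (u k) + (if k \<in> L then max 0 (w - V k) else 0)))"

text \<open>At \<open>w = v i\<close> the index classes are the branches of the minimum and the
  maximum: on \<open>K1\<close> the minimum is \<open>w\<close> and, as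
  \<open>u k \<le> v k\<close>, the maximum vanishes; on \<open>K2\<close> they add up to
  \<open>u k + w - v k\<close>; on \<open>K3\<close> to \<open>u k\<close>. Multiplying by
  \<open>v i\<close> clears the denominators.\<close>

lemma dim_number_at_finite:
  assumes u: "\<And>i. 0 < u i" "\<And>i. ereal (u i) \<le> v i" and i: "i \<in> fin_idx v"
  shows "dim_number_at \<delta> u v i * real_of_ereal (v i)
           = mass_exponent \<delta> u (fin_idx v) (\<lambda>k. real_of_ereal (v k)) (real_of_ereal (v i))"
proof -
  define V where "V = (\<lambda>k. real_of_ereal (v k))"
  have fin: "k \<in> fin_idx v \<Longrightarrow> v k = ereal (V k)" for k
    using u(2)[of k] by (cases "v k") (auto simp: fin_idx_def V_def)
  have uV: "k \<in> fin_idx v \<Longrightarrow> u k \<le> V k" for k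
    using u(2)[of k] fin[of k] by simp
  have inf: "k \<notin> fin_idx v \<Longrightarrow> v k = \<infinity>" for k
    by (simp add: fin_idx_def)
  have Vi: "0 < V i" using uV[OF i] u(1)[of i] by linarith
  have K1: "K1 u v i = {k. V i < u k}" using fin[OF i] by (simp add: K1_def)
  have K2: "K2 v i = {k \<in> fin_idx v. V k \<le> V i}"
    using fin fin[OF i] by (auto simp: K2_def)
  define g where "g k = \<delta> k * (min (V i) (u k) + (if k \<in> fin_idx v then max 0 (V i - V k) else 0))" for k
  have disj: "K1 u v i \<inter> K2 v i = {}" unfolding K1 K2 using uV by fastforce
  have "sum g UNIV = sum g (K1 u v i \<union> K2 v i) + sum g (K3 u v i)"
    unfolding K3_def using sum.subset_diff[of "K1 u v i \<union> K2 v i" UNIV g] by (simp add: add.commute)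
  also have "sum g (K1 u v i \<union> K2 v i) = sum g (K1 u v i) + sum g (K2 v i)"
    by (rule sum.union_disjoint) (use disj in auto)
  finally have split: "sum g UNIV = sum g (K1 u v i) + sum g (K2 v i) + sum g (K3 u v i)" .
  have 1: "sum g (K1 u v i) = (\<Sum>k\<in>K1 u v i. \<delta> k) * V i"
    unfolding sum_distrib_right
  proof (rule sum.cong)
    fix k assume "k \<in> K1 u v i"
    then have "V i < u k" by (simp add: K1)
    then show "g k = \<delta> k * V i" using uV[of k] by (auto simp: g_def)
  qed simp
  have 2: "sum g (K2 v i) = (\<Sum>k\<in>K2 v i. \<delta> k * (1 - (V k - u k) / V i)) * V i"
    unfolding sum_distrib_right
  proof (rule sum.cong)
    fix k assume "k \<in> K2 v i"
    then have "V k \<le> V i" "k \<in> fin_idx v" by (auto simp: K2)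
    then show "g k = \<delta> k * (1 - (V k - u k) / V i) * V i"
      using uV[of k] Vi by (auto simp: g_def field_simps)
  qed simp
  have 3: "sum g (K3 u v i) = (\<Sum>k\<in>K3 u v i. \<delta> k * u k / V i) * V i"
    unfolding sum_distrib_right
  proof (rule sum.cong)
    fix k assume "k \<in> K3 u v i"
    then have "u k \<le> V i" "k \<in> fin_idx v \<Longrightarrow> V i < V k" by (auto simp: K1 K2 K3_def)
    then show "g k = \<delta> k * u k / V i * V i" using Vi by (auto simp: g_def)
  qed simp
  have "((\<Sum>k\<in>K1 u v i. \<delta> k) + (\<Sum>k\<in>K2 v i. \<delta> k * (1 - (V k - u k) / V i))
      + (\<Sum>k\<in>K3 u v i. \<delta> k * u k / V i)) * V i = sum g UNIV"
    by (simp only: split 1 2 3 distrib_right)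
  then show ?thesis
    using i by (simp add: dim_number_at_def mass_exponent_def g_def V_def cong: if_cong)
qed

text \<open>On an interval whose interior contains no \<open>V k\<close> the exponent is concave in \<open>w\<close>, so it lies
  below the line \<open>\<alpha> w' + \<beta>\<close> touching it at \<open>w\<close>; according to the sign of \<open>\<beta>\<close>, the quotient by
  \<open>w\<close> decreases towards the next or towards the previous \<open>V i\<close>.\<close>
lemma dim_number_le_mass_exponent:
  assumes u: "\<And>i. 0 < u i" "\<And>i. ereal (u i) \<le> v i" and \<delta>: "\<And>i. 0 < \<delta> i" and w: "0 < w"
  shows "dim_number \<delta> u v * w \<le> mass_exponent \<delta> u (fin_idx v) (\<lambda>k. real_of_ereal (v k)) w"
proof -
  define L where "L = fin_idx v"
  define V where "V = (\<lambda>k. real_of_ereal (v k))"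
  define s where "s = dim_number \<delta> u v"
  let ?F = "mass_exponent \<delta> u L V"
  have uV: "k \<in> L \<Longrightarrow> u k \<le> V k" for k
    using u(2)[of k] by (cases "v k") (auto simp: fin_idx_def V_def L_def)
  have Vpos: "k \<in> L \<Longrightarrow> 0 < V k" for k using uV[of k] u(1)[of k] by linarith
  have s_le: "s \<le> dim_number_at \<delta> u v i" for i
    unfolding s_def dim_number_def by (rule Min_le) auto
  have at_V: "s * V i \<le> ?F (V i)" if "i \<in> L" for i
    using mult_right_mono[OF s_le[of i], of "V i"] dim_number_at_finite[of u v i \<delta>] u that Vpos[OF that]
    by (simp add: L_def V_def less_imp_le cong: if_cong)
  \<comment> \<open>The value at an index where \<open>v\<close> is infinite; it serves the scales
    beyond every finite \<open>V k\<close>.\<close>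
  have s_L: "s \<le> sum \<delta> L" if L: "L \<noteq> UNIV"
  proof -
    obtain i where "i \<notin> L" using L by blast
    then show ?thesis using s_le[of i] by (simp add: dim_number_at_def L_def)
  qed
  \<comment> \<open>Slope and intercept of the linear piece of the \<open>k\<close>-th summand
    active at \<open>w\<close>. The minimum is concave and stays below its piece everywhere; the
    maximum is convex and follows its piece only while no \<open>V k\<close> is crossed, hence the
    side conditions of \<open>up\<close> and \<open>down\<close>.\<close>
  define p where "p k = (if w < u k then 1 else 0) + (if k \<in> L \<and> V k < w then 1 else 0 :: real)" for k
  define q where "q k = (if w < u k then 0 else u k) - (if k \<in> L \<and> V k < w then V k else 0)" for k
  define \<alpha> where "\<alpha> = (\<Sum>k\<in>UNIV. \<delta> k * p k)"
  define \<beta> where "\<beta> = (\<Sum>k\<in>UNIV. \<delta> k * q k)"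
  have line: "\<alpha> * y + \<beta> = (\<Sum>k\<in>UNIV. \<delta> k * (p k * y + q k))" for y
    unfolding \<alpha>_def \<beta>_def sum_distrib_right sum.distrib[symmetric] by (simp add: algebra_simps)
  have F_w: "?F w = \<alpha> * w + \<beta>"
    unfolding line mass_exponent_def by (rule sum.cong) (auto simp: p_def q_def)
  have up: "?F y \<le> \<alpha> * y + \<beta>" if "w \<le> y" "\<And>k. k \<in> L \<Longrightarrow> w \<le> V k \<Longrightarrow> y \<le> V k" for y
    unfolding line mass_exponent_def
    by (rule sum_mono, rule mult_left_mono) (use that \<delta> in \<open>force simp: p_def q_def less_imp_le\<close>)+
  have down: "?F y \<le> \<alpha> * y + \<beta>" if "y \<le> w" "\<And>k. k \<in> L \<Longrightarrow> V k < w \<Longrightarrow> V k \<le> y" for y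
    unfolding line mass_exponent_def
    by (rule sum_mono, rule mult_left_mono) (use that \<delta> in \<open>force simp: p_def q_def less_imp_le\<close>)+
  \<comment> \<open>Along the line the quotient is \<open>\<alpha> + \<beta> / y\<close>, so
    \<open>\<beta> * w \<le> \<beta> * V i\<close> says that it does not increase from
    \<open>w\<close> to \<open>V i\<close>.\<close>
  have transport: "s * w \<le> ?F w" if "i \<in> L" "s * V i \<le> \<alpha> * V i + \<beta>" "\<beta> * w \<le> \<beta> * V i" for i
  proof -
    have "s * w * V i \<le> (\<alpha> * V i + \<beta>) * w"
      using mult_right_mono[OF that(2), of w] w by (simp add: algebra_simps)
    also have "\<dots> \<le> (\<alpha> * w + \<beta>) * V i" using that(3) by (simp add: algebra_simps)
    finally show ?thesis using Vpos[OF that(1)] F_w by simp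
  qed
  have case1: "s * w \<le> ?F w" if "0 \<le> \<beta>" and ex: "\<exists>k\<in>L. w \<le> V k"
  proof -
    define i where "i = arg_min_on V {k\<in>L. w \<le> V k}"
    have "i \<in> {k\<in>L. w \<le> V k}" unfolding i_def by (rule arg_min_if_finite) (use ex in auto)
    moreover have "V i \<le> V k" if "k \<in> L" "w \<le> V k" for k
      unfolding i_def by (rule arg_min_least) (use ex that in auto)
    ultimately show ?thesis
      using transport[of i] at_V[of i] up[of "V i"] \<open>0 \<le> \<beta>\<close> by (force intro: mult_left_mono)
  qed
  have case2: "s * w \<le> ?F w" if "\<beta> \<le> 0" and ex: "\<exists>k\<in>L. V k < w"
  proof -
    define i where "i = arg_min_on (\<lambda>k. - V k) {k\<in>L. V k < w}"
    have "i \<in> {k\<in>L. V k < w}" unfolding i_def by (rule arg_min_if_finite) (use ex in auto)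
    moreover have "V k \<le> V i" if "k \<in> L" "V k < w" for k
      using arg_min_least[of "{k\<in>L. V k < w}" k "\<lambda>k. - V k"] ex that by (auto simp: i_def)
    ultimately show ?thesis
      using transport[of i] at_V[of i] down[of "V i"] \<open>\<beta> \<le> 0\<close> by (force intro: mult_left_mono_neg)
  qed
  have "s * w \<le> ?F w"
  proof (cases "0 \<le> \<beta>")
    case True
    show ?thesis
    proof (cases "\<exists>k\<in>L. w \<le> V k")
      case False
      \<comment> \<open>No \<open>V k\<close> remains to move up to. If \<open>L = UNIV\<close>, all
        intercepts are \<open>u k - V k \<le> 0\<close>, so \<open>\<beta>\<close> vanishes and the
        step down applies; otherwise every \<open>k\<close> in \<open>L\<close> has slope at least
        1, and \<open>\<alpha>\<close> alone dominates \<open>s\<close>.\<close>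
      then have lt: "k \<in> L \<Longrightarrow> V k < w" for k by force
      show ?thesis
      proof (cases "L = UNIV")
        case True
        have "q k \<le> 0" for k using lt[of k] uV[of k] True by (auto simp: q_def)
        then have "\<beta> \<le> 0" unfolding \<beta>_def
          by (intro sum_nonpos mult_nonneg_nonpos) (use \<delta> in \<open>auto simp: less_imp_le\<close>)
        then show ?thesis using case2 lt True by auto
      next
        case False
        have "s \<le> sum \<delta> L" by (rule s_L[OF False])
        also have "\<dots> = (\<Sum>k\<in>L. \<delta> k * 1)" by simp
        also have "\<dots> \<le> (\<Sum>k\<in>L. \<delta> k * p k)"
          by (intro sum_mono mult_left_mono) (use lt \<delta> in \<open>auto simp: p_def less_imp_le\<close>)
        also have "\<dots> \<le> \<alpha>" unfolding \<alpha>_def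
          by (intro sum_mono2) (use \<delta> in \<open>auto simp: p_def less_imp_le\<close>)
        finally show ?thesis using F_w True w by (simp add: add_increasing2 mult_right_mono)
      qed
    qed (use True case1 in auto)
  next
    case False
    \<comment> \<open>Without such a \<open>k\<close> every intercept is 0 or \<open>u k\<close>,
      against \<open>\<beta> < 0\<close>.\<close>
    have "\<exists>k\<in>L. V k < w"
    proof (rule ccontr)
      assume "\<not> ?thesis"
      then have "0 \<le> q k" for k using u(1)[of k] by (auto simp: q_def)
      then have "0 \<le> \<beta>" unfolding \<beta>_def
        by (intro sum_nonneg mult_nonneg_nonneg) (use \<delta> in \<open>auto simp: less_imp_le\<close>)
      then show False using False by simp
    qed
    then show ?thesis using case2 False by simp
  qed
  then show ?thesis by (simp add: s_def L_def V_def)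
qed

text \<open>The exponents of the small balls only converge to \<open>v\<close> and may exceed it;
  the factor \<open>1 + \<epsilon>\<close> makes room for that. Only indices with
  \<open>V k \<le> w\<close> feel the stretch, and there the loss \<open>\<epsilon> * V k\<close> is
  at most \<open>\<epsilon> * w\<close>.\<close>

lemma mass_exponent_stretch:
  assumes \<delta>: "\<And>i. 0 < \<delta> i" and w: "0 < w" and \<epsilon>: "0 \<le> \<epsilon>"
  shows "mass_exponent \<delta> u L V w - \<epsilon> * (\<Sum>i\<in>UNIV. \<delta> i) * w
           \<le> mass_exponent \<delta> u L (\<lambda>k. (1 + \<epsilon>) * V k) w"
proof -
  have "\<epsilon> * (\<Sum>i\<in>UNIV. \<delta> i) * w = (\<Sum>i\<in>UNIV. \<delta> i * (\<epsilon> * w))"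
    by (simp add: sum_distrib_right sum_distrib_left mult_ac)
  then have "mass_exponent \<delta> u L V w - \<epsilon> * (\<Sum>i\<in>UNIV. \<delta> i) * w
    = (\<Sum>k\<in>UNIV. \<delta> k * (min w (u k) + (if k \<in> L then max 0 (w - V k) else 0) - \<epsilon> * w))"
    unfolding mass_exponent_def by (simp add: sum_subtractf[symmetric] algebra_simps)
  also have "\<dots> \<le> mass_exponent \<delta> u L (\<lambda>k. (1 + \<epsilon>) * V k) w"
    unfolding mass_exponent_def
  proof (intro sum_mono mult_left_mono)
    fix k
    have "0 \<le> \<epsilon> * w" using w \<epsilon> by simp
    moreover have "\<epsilon> * V k \<le> \<epsilon> * w" if "V k \<le> w" using that \<epsilon> by (rule mult_left_mono)
    ultimately show "min w (u k) + (if k \<in> L then max 0 (w - V k) else 0) - \<epsilon> * w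
      \<le> min w (u k) + (if k \<in> L then max 0 (w - (1 + \<epsilon>) * V k) else 0)"
      by (auto simp: max_def algebra_simps)
  qed (use \<delta> in \<open>auto simp: less_imp_le\<close>)
  finally show ?thesis .
qed

text \<open>Writing \<open>\<rho>\<close> as a power \<open>r powr w\<close> turns the product into
  a power of \<open>r\<close> with exponent \<open>mass_exponent\<close>, up to a factor 2 per
  coordinate that comes from \<open>r powr V i \<le> 2 * e i\<close>. The bound is uniform in
  \<open>r\<close>.\<close>

lemma rectangle_content_bound:
  assumes r: "0 < r" "r < 1" and \<rho>: "0 < \<rho>" "\<rho> < 1"
    and \<delta>: "\<And>i. 0 < \<delta> i"
    and e: "\<And>i. 0 < e i" "\<And>i. i \<in> L \<Longrightarrow> r powr V i \<le> 2 * e i"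
    and exponent: "\<And>w. 0 < w \<Longrightarrow> t * w \<le> mass_exponent \<delta> u L V w"
  shows "(\<Prod>i\<in>UNIV. (max \<rho> (r powr u i) * min 1 (\<rho> / e i)) powr \<delta> i)
           \<le> 2 powr (\<Sum>i\<in>UNIV. \<delta> i) * \<rho> powr t"
proof -
  define w where "w = ln \<rho> / ln r"
  have w: "0 < w" using r \<rho> by (simp add: w_def divide_neg_neg)
  have \<rho>_eq: "\<rho> = r powr w" using r \<rho> by (simp add: w_def powr_def)
  define h where "h k = min w (u k) + (if k \<in> L then max 0 (w - V k) else 0)" for k
  have factor: "max \<rho> (r powr u i) * min 1 (\<rho> / e i) \<le> 2 * r powr h i" for i
  proof -
    have mx: "max \<rho> (r powr u i) = r powr min w (u i)"
      unfolding \<rho>_eq using r by (auto simp: max_def min_def powr_le_one_le powr_mono' dest: powr_mono'[of _ _ r] intro: antisym)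
    show ?thesis
    proof (cases "i \<in> L")
      case True
      have "\<rho> / e i \<le> 2 * r powr (w - V i)"
        using e(1)[of i] e(2)[OF True] \<rho>(1) r unfolding powr_diff \<rho>_eq[symmetric]
        by (simp add: field_simps)
      then have "min 1 (\<rho> / e i) \<le> 2 * r powr max 0 (w - V i)"
        using r by (auto simp: max_def)
      then show ?thesis unfolding mx using True
        using mult_left_mono[of "min 1 (\<rho> / e i)" "2 * r powr max 0 (w - V i)" "r powr min w (u i)"]
        by (simp add: h_def powr_add mult.left_commute)
    next
      case False
      have "r powr h i * min 1 (\<rho> / e i) \<le> r powr h i * 2" by (intro mult_left_mono) auto
      then show ?thesis unfolding mx using False by (simp add: h_def)
    qed
  qed
  have "(\<Prod>i\<in>UNIV. (max \<rho> (r powr u i) * min 1 (\<rho> / e i)) powr \<delta> i)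
      \<le> (\<Prod>i\<in>UNIV. (2 * r powr h i) powr \<delta> i)"
    by (intro prod_mono conjI powr_mono2 factor) (use \<delta> \<rho> e(1) in \<open>auto simp: less_imp_le\<close>)
  also have "\<dots> = (\<Prod>i\<in>UNIV. 2 powr \<delta> i) * (\<Prod>i\<in>UNIV. r powr (\<delta> i * h i))"
    by (simp add: powr_mult powr_powr prod.distrib mult.commute)
  also have "\<dots> = 2 powr (\<Sum>i\<in>UNIV. \<delta> i) * r powr mass_exponent \<delta> u L V w"
    using r by (simp add: powr_sum mass_exponent_def h_def)
  also have "\<dots> \<le> 2 powr (\<Sum>i\<in>UNIV. \<delta> i) * r powr (t * w)"
    using r exponent[OF w] by (intro mult_left_mono powr_mono') auto
  also have "r powr (t * w) = \<rho> powr t" unfolding \<rho>_eq by (simp add: powr_powr mult.commute)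
  finally show ?thesis .
qed

subsection \<open>Products of regular spaces\<close>

locale regular_product =
  fixes X :: "'p::finite \<Rightarrow> 'a::euclidean_space set"
    and \<mu> :: "'p \<Rightarrow> 'a measure"
    and \<delta> :: "'p \<Rightarrow> real"
    and a b r0 :: real
  assumes sets_factor: "\<And>i. sets (\<mu> i) = sets (restrict_space borel (X i))"
    and prob_factor: "\<And>i. prob_space (\<mu> i)"
    and \<delta>_pos: "\<And>i. 0 < \<delta> i"
    and a_pos: "0 < a" and b_pos: "0 < b" and r0_pos: "0 < r0"
    and lower: "\<And>i y s. y \<in> X i \<Longrightarrow> 0 < s \<Longrightarrow> s \<le> r0 \<Longrightarrow> a * s powr \<delta> i \<le> measure (\<mu> i) (ball_in (X i) y s)"
    and upper: "\<And>i y s. y \<in> X i \<Longrightarrow> 0 < s \<Longrightarrow> s \<le> r0 \<Longrightarrow> measure (\<mu> i) (ball_in (X i) y s) \<le> b * s powr \<delta> i"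
begin

abbreviation M :: "('p \<Rightarrow> 'a) measure" where "M \<equiv> PiM UNIV \<mu>"

definition box :: "('p \<Rightarrow> 'a) \<Rightarrow> ('p \<Rightarrow> real) \<Rightarrow> ('p \<Rightarrow> 'a) set" where
  "box y s = PiE UNIV (\<lambda>i. ball_in (X i) (y i) (s i))"

abbreviation cube :: "('p \<Rightarrow> 'a) \<Rightarrow> real \<Rightarrow> ('p \<Rightarrow> 'a) set" where
  "cube y \<rho> \<equiv> box y (\<lambda>_. \<rho>)"

abbreviation \<Delta> :: real where "\<Delta> \<equiv> \<Sum>i\<in>UNIV. \<delta> i"

lemma mem_box: "z \<in> box y s \<longleftrightarrow> (\<forall>i. z i \<in> X i \<and> dist (y i) (z i) < s i)"
  by (auto simp: box_def ball_in_def)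

lemma space_factor: "space (\<mu> i) = X i"
  using sets_eq_imp_space_eq[OF sets_factor[of i]] by (simp add: space_restrict_space)

lemma sets_ball_in [measurable]: "ball_in (X i) y s \<in> sets (\<mu> i)"
  unfolding sets_factor sets_restrict_space ball_in_def
  by (rule image_eqI[of _ _ "ball y s"]) (auto simp: Int_commute)

lemma sets_box [measurable]: "box y s \<in> sets M"
  unfolding box_def by (rule sets_PiM_I_finite) auto

lemma space_M: "space M = PiE UNIV X"
  by (simp add: space_PiM space_factor)

lemma mem_space: "z \<in> space M \<longleftrightarrow> (\<forall>i. z i \<in> X i)"
  by (auto simp: space_M)

sublocale product: finite_product_prob_space \<mu> UNIV
proof -
  interpret product_prob_space \<mu>
    by (intro product_prob_space.intro product_sigma_finite.intro product_prob_space_axioms.intro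
        prob_space_imp_sigma_finite prob_factor)
  show "finite_product_prob_space \<mu> UNIV"
    by unfold_locales auto
qed

lemma measure_box: "measure M (box y s) = (\<Prod>i\<in>UNIV. measure (\<mu> i) (ball_in (X i) (y i) (s i)))"
  unfolding box_def by (rule product.prob_times) auto

lemma box_lower:
  assumes "\<And>i. y i \<in> X i" "\<And>i. 0 < s i" "\<And>i. s i \<le> r0"
  shows "a ^ CARD('p) * (\<Prod>i\<in>UNIV. s i powr \<delta> i) \<le> measure M (box y s)"
proof -
  have "(\<Prod>i\<in>UNIV. a * s i powr \<delta> i) \<le> measure M (box y s)"
    unfolding measure_box by (intro prod_mono conjI lower assms) (use a_pos in auto)
  then show ?thesis by (simp add: prod.distrib)
qed

lemma box_upper:
  assumes "\<And>i. y i \<in> X i" "\<And>i. 0 < s i" "\<And>i. s i \<le> r0"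
  shows "measure M (box y s) \<le> b ^ CARD('p) * (\<Prod>i\<in>UNIV. s i powr \<delta> i)"
proof -
  have "measure M (box y s) \<le> (\<Prod>i\<in>UNIV. b * s i powr \<delta> i)"
    unfolding measure_box by (intro prod_mono conjI upper assms) auto
  then show ?thesis by (simp add: prod.distrib)
qed

lemma box_pos:
  assumes "\<And>i. y i \<in> X i" "\<And>i. 0 < s i" "\<And>i. s i \<le> r0"
  shows "0 < measure M (box y s)"
  by (rule less_le_trans[OF _ box_lower[OF assms]])
     (use a_pos assms(2) in \<open>auto intro!: mult_pos_pos prod_pos simp: less_imp_neq[THEN not_sym]\<close>)

lemma prod_scale:
  assumes "0 < c" "\<And>i. 0 \<le> s i"
  shows "(\<Prod>i\<in>UNIV. (c * s i) powr \<delta> i) = c powr \<Delta> * (\<Prod>i\<in>UNIV. s i powr \<delta> i)"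
  using assms by (simp add: powr_mult prod.distrib powr_sum)

text \<open>The intersection is again a product, and in each coordinate it lies in both balls, so
  the smaller radius counts.\<close>

lemma box_Int_cube_upper:
  assumes "\<And>i. c i \<in> X i" "\<And>i. y i \<in> X i" "\<And>i. 0 < s i" "\<And>i. s i \<le> r0" "0 < \<rho>" "\<rho> \<le> r0"
  shows "measure M (box c s \<inter> cube y \<rho>) \<le> b ^ CARD('p) * (\<Prod>i\<in>UNIV. min (s i) \<rho> powr \<delta> i)"
proof -
  have eq: "box c s \<inter> cube y \<rho> = PiE UNIV (\<lambda>i. ball_in (X i) (c i) (s i) \<inter> ball_in (X i) (y i) \<rho>)"
    by (auto simp: box_def)
  have "measure M (box c s \<inter> cube y \<rho>)
    = (\<Prod>i\<in>UNIV. measure (\<mu> i) (ball_in (X i) (c i) (s i) \<inter> ball_in (X i) (y i) \<rho>))"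
    unfolding eq by (rule product.prob_times) auto
  also have "\<dots> \<le> (\<Prod>i\<in>UNIV. b * min (s i) \<rho> powr \<delta> i)"
  proof (intro prod_mono conjI)
    fix i
    let ?B = "ball_in (X i) (c i) (s i) \<inter> ball_in (X i) (y i) \<rho>"
    have "measure (\<mu> i) ?B \<le> measure (\<mu> i) (ball_in (X i) (c i) (s i))"
      by (rule product.M.finite_measure_mono) auto
    also have "\<dots> \<le> b * s i powr \<delta> i" using assms by (intro upper)
    finally have 1: "measure (\<mu> i) ?B \<le> b * s i powr \<delta> i" .
    have "measure (\<mu> i) ?B \<le> measure (\<mu> i) (ball_in (X i) (y i) \<rho>)"
      by (rule product.M.finite_measure_mono) auto
    also have "\<dots> \<le> b * \<rho> powr \<delta> i" using assms by (intro upper)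
    finally have 2: "measure (\<mu> i) ?B \<le> b * \<rho> powr \<delta> i" .
    show "measure (\<mu> i) (ball_in (X i) (c i) (s i) \<inter> ball_in (X i) (y i) \<rho>) \<le> b * min (s i) \<rho> powr \<delta> i"
      using 1 2 by (simp add: min_def)
  qed auto
  finally show ?thesis by (simp add: prod.distrib)
qed

text \<open>Mass \<open>w\<close>, at most \<open>H\<close> times the measure of the threefold box,
  is spread evenly over the core, and the part landing in a cube is estimated. The product of minima
  is kept because \<open>packing_bound\<close> sums it over disjoint boxes to a multiple of
  \<open>\<rho> powr \<Delta>\<close>, which cancels the \<open>- \<Delta>\<close> in the
  exponent.\<close>

lemma density_on_box_bound:
  assumes H: "0 \<le> H" "0 \<le> w" "w \<le> H * measure M (box c (\<lambda>i. 3 * U i))"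
    and c: "\<And>i. c i \<in> X i" and y: "\<And>i. y i \<in> X i"
    and U: "\<And>i. 3 * U i \<le> r0" and e: "\<And>i. 0 < e i" "\<And>i. 2 * e i \<le> U i"
    and \<rho>: "0 < \<rho>" "\<rho> \<le> r0"
    and content: "(\<Prod>i\<in>UNIV. (max \<rho> (U i) * min 1 (\<rho> / e i)) powr \<delta> i) \<le> D * \<rho> powr t"
  shows "w / measure M (box c e) * measure M (box c e \<inter> cube y \<rho>)
    \<le> H * b ^ CARD('p) * b ^ CARD('p) / a ^ CARD('p) * 3 powr \<Delta> * D * \<rho> powr (t - \<Delta>)
       * (\<Prod>i\<in>UNIV. min \<rho> (U i) powr \<delta> i)"
proof -
  have U0: "0 < U i" for i using e[of i] by linarith
  have er: "e i \<le> r0" for i using e[of i] U[of i] by linarith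
  let ?P = "\<lambda>f. \<Prod>i\<in>UNIV. f i powr \<delta> i"
  let ?a = "a ^ CARD('p)" and ?b = "b ^ CARD('p)"
  have b: "0 < ?b" and a: "0 < ?a" using a_pos b_pos by auto
  have w: "w \<le> H * (?b * (3 powr \<Delta> * ?P U))"
  proof -
    have "measure M (box c (\<lambda>i. 3 * U i)) \<le> ?b * (3 powr \<Delta> * ?P U)"
      using box_upper[of c "\<lambda>i. 3 * U i"] c U U0 prod_scale[of 3 U] by (simp add: less_imp_le)
    then show ?thesis using H by (meson mult_left_mono order_trans)
  qed
  have pe: "0 < ?P e" using e by (auto intro!: prod_pos simp: less_imp_neq[THEN not_sym])
  have "w / measure M (box c e) * measure M (box c e \<inter> cube y \<rho>)
    \<le> H * (?b * (3 powr \<Delta> * ?P U)) / (?a * ?P e) * (?b * ?P (\<lambda>i. min (e i) \<rho>))"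
    using box_lower[of c e] box_Int_cube_upper[of c y e \<rho>] c y e er \<rho> w H a pe box_pos[of c e] b
    by (intro mult_mono frac_le) (auto intro!: mult_nonneg_nonneg prod_nonneg)
  also have "\<dots> = H * ?b * ?b / ?a * 3 powr \<Delta> * (?P U * (?P (\<lambda>i. min (e i) \<rho>) / ?P e))"
    by simp
  \<comment> \<open>In each coordinate
    \<open>min \<rho> (U i) * max \<rho> (U i) = \<rho> * U i\<close> separates the factor to be
    summed later from the one that \<open>content\<close> controls.\<close>
  also have "?P U * (?P (\<lambda>i. min (e i) \<rho>) / ?P e)
    = ?P (\<lambda>i. min \<rho> (U i)) * ?P (\<lambda>i. max \<rho> (U i) * min 1 (\<rho> / e i)) * \<rho> powr (- \<Delta>)"
  proof -
    have "U i powr \<delta> i * (min (e i) \<rho> powr \<delta> i / e i powr \<delta> i)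
      = min \<rho> (U i) powr \<delta> i * (max \<rho> (U i) * min 1 (\<rho> / e i)) powr \<delta> i * \<rho> powr (- \<delta> i)" for i
    proof -
      have "min 1 (\<rho> / e i) = min (e i) \<rho> / e i" using e(1)[of i] by (auto simp: min_def)
      then have "min \<rho> (U i) * (max \<rho> (U i) * min 1 (\<rho> / e i)) / \<rho> = U i * (min (e i) \<rho> / e i)"
        using \<rho> by (auto simp: min_def max_def)
      then have "U i powr \<delta> i * (min (e i) \<rho> / e i) powr \<delta> i
        = (min \<rho> (U i) * (max \<rho> (U i) * min 1 (\<rho> / e i)) / \<rho>) powr \<delta> i"
        using powr_mult[of "U i" "min (e i) \<rho> / e i" "\<delta> i"] U0[of i] e(1)[of i] \<rho> by simp
      also have "\<dots> = min \<rho> (U i) powr \<delta> i * (max \<rho> (U i) * min 1 (\<rho> / e i)) powr \<delta> i * \<rho> powr (- \<delta> i)"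
        using U0[of i] e(1)[of i] \<rho> by (simp add: powr_mult powr_divide powr_minus_divide)
      finally show ?thesis using e(1)[of i] \<rho> by (simp add: powr_divide)
    qed
    then show ?thesis using \<rho>
      by (simp add: prod_dividef[symmetric] prod.distrib[symmetric] powr_sum sum_negf[symmetric])
  qed
  also have "H * ?b * ?b / ?a * 3 powr \<Delta> * (?P (\<lambda>i. min \<rho> (U i))
      * ?P (\<lambda>i. max \<rho> (U i) * min 1 (\<rho> / e i)) * \<rho> powr (- \<Delta>))
    \<le> H * ?b * ?b / ?a * 3 powr \<Delta> * (?P (\<lambda>i. min \<rho> (U i)) * (D * \<rho> powr t) * \<rho> powr (- \<Delta>))"
    using content H a b
    by (intro mult_left_mono mult_right_mono) (auto intro!: mult_nonneg_nonneg prod_nonneg)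
  also have "\<dots> = H * ?b * ?b / ?a * 3 powr \<Delta> * D * \<rho> powr (t - \<Delta>) * ?P (\<lambda>i. min \<rho> (U i))"
    by (simp add: powr_diff powr_minus_divide)
  finally show ?thesis .
qed

text \<open>The cores meeting a small cube belong to disjoint boxes, each of which fills a definite part
  of the doubled cube.\<close>
lemma packing_bound:
  assumes S: "finite S" and disj: "disjoint_family_on (\<lambda>n. box (c n) (U n)) S"
    and c: "\<And>n i. c n i \<in> X i" and y: "\<And>i. y i \<in> X i"
    and e: "\<And>n i. n \<in> S \<Longrightarrow> 0 < U n i" "\<And>n i. n \<in> S \<Longrightarrow> 2 * e n i \<le> U n i"
    and \<rho>: "0 < \<rho>" "2 * \<rho> \<le> r0"
    and meet: "\<And>n. n \<in> S \<Longrightarrow> box (c n) (e n) \<inter> cube y \<rho> \<noteq> {}"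
  shows "(\<Sum>n\<in>S. \<Prod>i\<in>UNIV. min \<rho> (U n i) powr \<delta> i)
           \<le> b ^ CARD('p) / a ^ CARD('p) * 4 powr \<Delta> * \<rho> powr \<Delta>"
proof -
  let ?a = "a ^ CARD('p)" and ?b = "b ^ CARD('p)"
  have b: "0 < ?b" and a: "0 < ?a" using a_pos b_pos by auto
  have "\<forall>n\<in>S. \<exists>z. z \<in> box (c n) (e n) \<and> z \<in> cube y \<rho>" using meet by blast
  then obtain z where z: "\<And>n. n \<in> S \<Longrightarrow> z n \<in> box (c n) (e n)" "\<And>n. n \<in> S \<Longrightarrow> z n \<in> cube y \<rho>"
    by metis
  \<comment> \<open>The halved radii keep the box inside the disjoint box of \<open>n\<close>, since
    \<open>2 * e n i \<le> U n i\<close>, and inside the doubled cube. Halving and doubling together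
    give \<open>4 powr \<Delta>\<close>.\<close>
  define B where "B n = box (z n) (\<lambda>i. min \<rho> (U n i) / 2)" for n
  have B1: "B n \<subseteq> box (c n) (U n)" if "n \<in> S" for n
  proof
    fix q assume "q \<in> B n"
    then have q: "q i \<in> X i" "dist (z n i) (q i) < min \<rho> (U n i) / 2" for i by (auto simp: B_def mem_box)
    have "dist (c n i) (q i) < U n i" for i
      using q(2)[of i] z(1)[OF that] e(2)[OF that, of i] dist_triangle[of "c n i" "q i" "z n i"]
      unfolding mem_box by (smt (verit) field_sum_of_halves)
    then show "q \<in> box (c n) (U n)" using q by (simp add: mem_box)
  qed
  have B2: "B n \<subseteq> cube y (2 * \<rho>)" if "n \<in> S" for n
  proof
    fix q assume "q \<in> B n"
    then have q: "q i \<in> X i" "dist (z n i) (q i) < min \<rho> (U n i) / 2" for i by (auto simp: B_def mem_box)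
    have "dist (y i) (q i) < 2 * \<rho>" for i
      using q(2)[of i] z(2)[OF that] \<rho> dist_triangle[of "y i" "q i" "z n i"]
      unfolding mem_box by (smt (verit) field_sum_of_halves)
    then show "q \<in> cube y (2 * \<rho>)" using q by (simp add: mem_box)
  qed
  have low: "?a * ((1/2) powr \<Delta> * (\<Prod>i\<in>UNIV. min \<rho> (U n i) powr \<delta> i)) \<le> measure M (B n)" if "n \<in> S" for n
  proof -
    have "z n i \<in> X i" for i using z(1)[OF that] by (simp add: mem_box)
    then have "?a * (\<Prod>i\<in>UNIV. (1/2 * min \<rho> (U n i)) powr \<delta> i) \<le> measure M (B n)"
      using box_lower[of "z n" "\<lambda>i. min \<rho> (U n i) / 2"] \<rho> e(1)[OF that] by (simp add: B_def)
    then show ?thesis by (subst (asm) prod_scale) (use \<rho> e(1)[OF that] in \<open>auto simp: less_imp_le\<close>)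
  qed
  have "?a * (1/2) powr \<Delta> * (\<Sum>n\<in>S. \<Prod>i\<in>UNIV. min \<rho> (U n i) powr \<delta> i)
      = (\<Sum>n\<in>S. ?a * ((1/2) powr \<Delta> * (\<Prod>i\<in>UNIV. min \<rho> (U n i) powr \<delta> i)))"
    by (simp add: sum_distrib_left mult.assoc)
  also have "\<dots> \<le> (\<Sum>n\<in>S. measure M (B n))" by (rule sum_mono) (rule low)
  also have "\<dots> = measure M (\<Union>n\<in>S. B n)"
  proof (rule product.finite_measure_finite_Union[symmetric])
    show "disjoint_family_on B S" using disj B1 unfolding disjoint_family_on_def by fast
  qed (use S in \<open>auto simp: B_def\<close>)
  also have "\<dots> \<le> measure M (cube y (2 * \<rho>))"
    using B2 by (intro product.finite_measure_mono) auto
  also have "\<dots> \<le> ?b * (2 powr \<Delta> * \<rho> powr \<Delta>)"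
    using box_upper[of y "\<lambda>_. 2 * \<rho>"] y \<rho> prod_scale[of 2 "\<lambda>_. \<rho>"] by (simp add: powr_sum)
  finally have "(\<Sum>n\<in>S. \<Prod>i\<in>UNIV. min \<rho> (U n i) powr \<delta> i)
      \<le> ?b * (2 powr \<Delta> * \<rho> powr \<Delta>) / (?a * (1/2) powr \<Delta>)"
    using a by (simp add: pos_le_divide_eq mult.commute)
  also have "\<dots> = ?b / ?a * 4 powr \<Delta> * \<rho> powr \<Delta>"
    using powr_mult[of 2 2 \<Delta>] by (simp add: powr_divide)
  finally show ?thesis .
qed

end

subsection \<open>Moving mass from big to small rectangles\<close>

lemma (in regular_product) box_relopen:
  assumes "z \<in> box y s" "\<And>i. 0 < s i"
  shows "\<exists>\<eta>>0. cube z \<eta> \<subseteq> box y s"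
proof -
  define \<eta> where "\<eta> = Min (range (\<lambda>i. s i - dist (y i) (z i)))"
  have "0 < \<eta>" using assms by (auto simp: \<eta>_def mem_box)
  moreover have "dist (y i) (w i) < s i" if "w \<in> cube z \<eta>" for w i
  proof -
    have "\<eta> \<le> s i - dist (y i) (z i)" unfolding \<eta>_def by (rule Min_le) auto
    moreover have "dist (z i) (w i) < \<eta>" using that by (simp add: mem_box)
    ultimately show ?thesis using dist_triangle[of "y i" "w i" "z i"] by linarith
  qed
  ultimately show ?thesis by (intro exI[of _ \<eta>]) (auto simp: mem_box)
qed

text \<open>A density with respect to \<open>M\<close>; overlaps of the \<open>B n\<close> do no
  harm, since weights add. All later estimates become finite sums.\<close>

lemma (in regular_product) weighted_restriction:
  assumes S: "finite S" and w: "\<And>n. n \<in> S \<Longrightarrow> (0::real) \<le> w n" and B: "\<And>n. n \<in> S \<Longrightarrow> B n \<in> sets M"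
  obtains \<nu> where "sets \<nu> = sets M" "finite_measure \<nu>"
    "\<And>A. A \<in> sets M \<Longrightarrow> measure \<nu> A = (\<Sum>n\<in>S. w n * measure M (B n \<inter> A))"
proof
  define \<nu> where "\<nu> = density M (\<lambda>z. \<Sum>n\<in>S. ennreal (w n) * indicator (B n) z)"
  show sets: "sets \<nu> = sets M" by (simp add: \<nu>_def)
  have em: "emeasure \<nu> A = ennreal (\<Sum>n\<in>S. w n * measure M (B n \<inter> A))" if A: "A \<in> sets M" for A
  proof -
    have "emeasure \<nu> A = (\<integral>\<^sup>+z. (\<Sum>n\<in>S. ennreal (w n) * indicator (B n) z) * indicator A z \<partial>M)"
      unfolding \<nu>_def using A
      by (intro emeasure_density borel_measurable_sum borel_measurable_times_ennreal borel_measurable_indicator B) auto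
    also have "\<dots> = (\<integral>\<^sup>+z. (\<Sum>n\<in>S. ennreal (w n) * indicator (B n \<inter> A) z) \<partial>M)"
      by (intro nn_integral_cong) (simp add: sum_distrib_right indicator_inter_arith mult.assoc)
    also have "\<dots> = (\<Sum>n\<in>S. \<integral>\<^sup>+z. ennreal (w n) * indicator (B n \<inter> A) z \<partial>M)"
      by (rule nn_integral_sum) (use B A in auto)
    also have "\<dots> = (\<Sum>n\<in>S. ennreal (w n) * emeasure M (B n \<inter> A))"
      by (intro sum.cong refl nn_integral_cmult_indicator) (use B A in auto)
    also have "\<dots> = (\<Sum>n\<in>S. ennreal (w n * measure M (B n \<inter> A)))"
      by (intro sum.cong refl) (simp add: product.emeasure_eq_measure ennreal_mult w)
    also have "\<dots> = ennreal (\<Sum>n\<in>S. w n * measure M (B n \<inter> A))"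
      by (rule sum_ennreal) (use w in auto)
    finally show ?thesis .
  qed
  show "measure \<nu> A = (\<Sum>n\<in>S. w n * measure M (B n \<inter> A))" if "A \<in> sets M" for A
    unfolding measure_def em[OF that] by (rule enn2real_ennreal) (auto intro!: sum_nonneg simp: w)
  show "finite_measure \<nu>"
    by (rule finite_measureI) (use em[of "space M"] sets_eq_imp_space_eq[OF sets] in simp)
qed

text \<open>\<open>t\<close> is the Frostman exponent to be reached and \<open>t'\<close> a larger
  one for which single rectangles satisfy the content bound, uniformly over all scales up to
  \<open>\<sigma>\<close> once \<open>n\<close> is large. By \<open>nested\<close> the parameter
  \<open>r\<close> orders the rectangles in all coordinates at once, which is what the Vitali
  selection requires.\<close>

locale rectangle_family = regular_product X \<mu> \<delta> a b r0
  for X :: "'p::finite \<Rightarrow> 'a::euclidean_space set" and \<mu> \<delta> a b r0 +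
  fixes c :: "nat \<Rightarrow> 'p \<Rightarrow> 'a" and U e :: "nat \<Rightarrow> 'p \<Rightarrow> real" and r :: "nat \<Rightarrow> real"
    and t t' D \<sigma> :: real
  assumes center: "\<And>n i. c n i \<in> X i"
    and e_pos: "\<And>n i. 0 < e n i" and e_le: "\<And>n i. 2 * e n i \<le> U n i"
    and nested: "\<And>m n i. r m \<le> r n \<Longrightarrow> U m i \<le> U n i"
    and U_lim: "\<And>i. (\<lambda>n. U n i) \<longlonglongrightarrow> 0"
    and full: "measure M (limsup (\<lambda>n. box (c n) (U n))) = 1"
    and t_nonneg: "0 \<le> t" and t_less: "t < t'" and D_pos: "0 < D" and \<sigma>_pos: "0 < \<sigma>"
    and content: "eventually (\<lambda>n. \<forall>\<rho>. 0 < \<rho> \<and> \<rho> \<le> \<sigma> \<longrightarrow>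
      (\<Prod>i\<in>UNIV. (max \<rho> (U n i) * min 1 (\<rho> / e n i)) powr \<delta> i) \<le> D * \<rho> powr t') sequentially"
begin

abbreviation rect :: "nat \<Rightarrow> ('p \<Rightarrow> 'a) set" where "rect n \<equiv> box (c n) (U n)"
abbreviation rect3 :: "nat \<Rightarrow> ('p \<Rightarrow> 'a) set" where "rect3 n \<equiv> box (c n) (\<lambda>i. 3 * U n i)"
abbreviation core :: "nat \<Rightarrow> ('p \<Rightarrow> 'a) set" where "core n \<equiv> box (c n) (e n)"

lemma U_pos: "0 < U n i"
  using e_pos[of n i] e_le[of n i] by linarith

section \<open>Vitali selection among rectangles ordered by size\<close>

lemma rect_subset_rect3:
  assumes "r n \<le> r m" "rect n \<inter> rect m \<noteq> {}"
  shows "rect n \<subseteq> rect3 m"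
proof
  fix z assume z: "z \<in> rect n"
  obtain w where w: "w \<in> rect n" "w \<in> rect m" using assms(2) by blast
  have "dist (c m i) (z i) < 3 * U m i" for i
  proof -
    have "dist (c m i) (z i) \<le> dist (c m i) (w i) + dist (w i) (c n i) + dist (c n i) (z i)"
      by metric
    also have "\<dots> < U m i + U n i + U n i"
      using z w unfolding mem_box by (intro add_strict_mono) (auto simp: dist_commute)
    finally show ?thesis using nested[OF assms(1), of i] by linarith
  qed
  then show "z \<in> rect3 m" using z by (simp add: mem_box)
qed

text \<open>Greedy choice. Ranking by \<open>- r\<close> makes the induction add indices in order of
  decreasing size, so a newcomer that meets a chosen rectangle is no larger and lies in its
  enlargement.\<close>

lemma vitali_finite:
  assumes "finite G"
  shows "\<exists>S\<subseteq>G. disjoint_family_on rect S \<and> (\<Union>n\<in>G. rect n) \<subseteq> (\<Union>n\<in>S. rect3 n)"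
  using assms
proof (induction G rule: finite_ranking_induct[where f = "\<lambda>n. - r n"])
  case empty
  then show ?case by (simp add: disjoint_family_on_def)
next
  case (insert n G)
  then obtain S where S: "S \<subseteq> G" "disjoint_family_on rect S" "(\<Union>n\<in>G. rect n) \<subseteq> (\<Union>n\<in>S. rect3 n)"
    by blast
  show ?case
  proof (cases "\<exists>m\<in>S. rect n \<inter> rect m \<noteq> {}")
    case True
    then obtain m where m: "m \<in> S" "rect n \<inter> rect m \<noteq> {}" by blast
    then have "rect n \<subseteq> rect3 m" using insert S by (intro rect_subset_rect3) auto
    then show ?thesis using S m by (intro exI[of _ S]) auto
  next
    case False
    have "rect n \<subseteq> rect3 n"
      unfolding subset_iff mem_box using U_pos[of n] by (auto intro: less_le_trans simp: less_imp_le)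
    moreover have "disjoint_family_on rect (insert n S)"
      using S(2) False unfolding disjoint_family_on_def by (metis Int_commute insert_iff)
    ultimately show ?thesis using S by (intro exI[of _ "insert n S"]) auto
  qed
qed

text \<open>The invariant of the construction. Bounded density makes \<open>M\<close>-null sets null
  for \<open>\<nu>\<close>; its bound \<open>H\<close> may change from step to step, while
  \<open>C\<close> is the Frostman constant to be kept under control. Relative openness of
  \<open>G\<close> lets small rectangles fit inside, and the strict bound \<open>m\<close> survives
  passing to finitely many rectangles.\<close>

definition spread :: "('p \<Rightarrow> 'a) measure \<Rightarrow> ('p \<Rightarrow> 'a) set \<Rightarrow> real \<Rightarrow> real \<Rightarrow> bool" where
  "spread \<nu> G C m \<longleftrightarrow>
     finite_measure \<nu> \<and> sets \<nu> = sets M \<and> G \<in> sets M \<and> measure \<nu> (space M - G) = 0 \<and>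
     (\<exists>H\<ge>0. \<forall>A\<in>sets M. measure \<nu> A \<le> H * measure M A) \<and>
     (\<forall>z\<in>G. \<exists>\<eta>>0. cube z \<eta> \<subseteq> G) \<and>
     (\<forall>y \<rho>. y \<in> space M \<longrightarrow> 0 < \<rho> \<longrightarrow> measure \<nu> (cube y \<rho>) \<le> C * \<rho> powr t) \<and>
     m < measure \<nu> (space M)"

lemma eventually_U_less:
  assumes "0 < \<eta>"
  shows "eventually (\<lambda>n. \<forall>i. U n i < \<eta>) sequentially"
  by (rule eventually_all_finite) (rule order_tendstoD(2)[OF U_lim assms])

text \<open>A limsup point lies in rectangles of arbitrarily late index, hence in arbitrarily small
  ones. Four side lengths suffice: one from the point to the centre, three across the
  enlargement.\<close>

lemma limsup_covered:
  assumes G: "\<forall>z\<in>G. \<exists>\<eta>>0. cube z \<eta> \<subseteq> G"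
  shows "G \<inter> limsup (\<lambda>n. rect n) \<subseteq> (\<Union>n\<in>{n. N \<le> n \<and> rect3 n \<subseteq> G}. rect n)"
proof
  fix z assume z: "z \<in> G \<inter> limsup rect"
  then obtain \<eta> where \<eta>: "0 < \<eta>" "cube z \<eta> \<subseteq> G" using G by blast
  obtain N' where N': "\<And>n i. N' \<le> n \<Longrightarrow> U n i < \<eta> / 4"
    using eventually_U_less[of "\<eta> / 4"] \<eta>(1) unfolding eventually_sequentially by auto
  have "z \<in> (\<Union>n\<in>{max N N'..}. rect n)" using z unfolding limsup_INF_SUP by blast
  then obtain n where n: "max N N' \<le> n" "z \<in> rect n" by auto
  have "rect3 n \<subseteq> cube z \<eta>"
  proof
    fix w assume w: "w \<in> rect3 n"
    have "dist (z i) (w i) < \<eta>" for i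
    proof -
      have "dist (z i) (w i) \<le> dist (c n i) (z i) + dist (c n i) (w i)" by metric
      also have "\<dots> < U n i + 3 * U n i" using w n(2) unfolding mem_box by (intro add_strict_mono) auto
      finally show ?thesis using N'[of n i] n(1) by simp
    qed
    then show "w \<in> cube z \<eta>" using w by (simp add: mem_box)
  qed
  then show "z \<in> (\<Union>n\<in>{n. N \<le> n \<and> rect3 n \<subseteq> G}. rect n)" using n \<eta> by auto
qed

lemma limsup_rect_sets: "limsup rect \<in> sets M"
  unfolding limsup_INF_SUP by (intro sets.countable_INT sets.countable_UN) auto

text \<open>Bounded density carries the full measure of the limsup set over to \<open>\<nu>\<close>,
  so the rectangles with enlargement in \<open>G\<close> cover almost everything. Continuity from
  below leaves finitely many of them with mass still above \<open>m\<close>, and the Vitali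
  selection thins these out.\<close>

lemma finite_selection:
  assumes \<nu>: "spread \<nu> G C m"
  obtains S where "finite S" "disjoint_family_on rect S" "\<And>n. n \<in> S \<Longrightarrow> N \<le> n" "\<And>n. n \<in> S \<Longrightarrow> rect3 n \<subseteq> G"
    "m < measure \<nu> (\<Union>n\<in>S. rect3 n)"
proof -
  have fm: "finite_measure \<nu>" and sets: "sets \<nu> = sets M" and G: "G \<in> sets M" "measure \<nu> (space M - G) = 0"
    and H: "\<exists>H\<ge>0. \<forall>A\<in>sets M. measure \<nu> A \<le> H * measure M A"
    and ro: "\<forall>z\<in>G. \<exists>\<eta>>0. cube z \<eta> \<subseteq> G" and m: "m < measure \<nu> (space M)"
    using \<nu> unfolding spread_def by blast+
  interpret \<nu>: finite_measure \<nu> by (rule fm)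
  define I where "I = {n. N \<le> n \<and> rect3 n \<subseteq> G}"
  define A where "A q = (\<Union>n\<in>I \<inter> {..q}. rect n)" for q
  have A_sets: "A q \<in> sets \<nu>" for q
    unfolding A_def sets by (intro sets.finite_UN) auto
  have "measure M (space M - limsup rect) = 0"
    using product.prob_compl[OF limsup_rect_sets] full by simp
  then have null: "measure \<nu> (space M - limsup rect) = 0"
  proof -
    obtain H where "measure \<nu> (space M - limsup rect) \<le> H * measure M (space M - limsup rect)"
      using H limsup_rect_sets by blast
    then show ?thesis
      using \<open>measure M (space M - limsup rect) = 0\<close> by (simp add: measure_le_0_iff)
  qed
  have "space M \<subseteq> (space M - G) \<union> (space M - limsup rect) \<union> (\<Union>q. A q)"
    using limsup_covered[OF ro, of N] by (fastforce simp: A_def I_def)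
  then have "measure \<nu> (space M) \<le> measure \<nu> ((space M - G) \<union> (space M - limsup rect) \<union> (\<Union>q. A q))"
    using A_sets G limsup_rect_sets by (intro \<nu>.finite_measure_mono sets.Un) (auto simp: sets)
  also have "\<dots> \<le> measure \<nu> ((space M - G) \<union> (space M - limsup rect)) + measure \<nu> (\<Union>q. A q)"
    using A_sets G limsup_rect_sets by (intro measure_Un_le) (auto simp: sets)
  also have "measure \<nu> ((space M - G) \<union> (space M - limsup rect))
      \<le> measure \<nu> (space M - G) + measure \<nu> (space M - limsup rect)"
    using G limsup_rect_sets by (intro measure_Un_le) (auto simp: sets)
  finally have "m < measure \<nu> (\<Union>q. A q)" using m G(2) null by simp
  moreover have "(\<lambda>q. measure \<nu> (A q)) \<longlonglongrightarrow> measure \<nu> (\<Union>q. A q)"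
    by (rule \<nu>.finite_Lim_measure_incseq) (use A_sets in \<open>auto simp: A_def incseq_def\<close>)
  ultimately obtain q where q: "m < measure \<nu> (A q)"
    using order_tendstoD(1) eventually_happens'[OF sequentially_bot] by blast
  obtain S where S: "S \<subseteq> I \<inter> {..q}" "disjoint_family_on rect S"
    "(\<Union>n\<in>I \<inter> {..q}. rect n) \<subseteq> (\<Union>n\<in>S. rect3 n)"
    using vitali_finite[of "I \<inter> {..q}"] by auto
  have fin: "finite S" using S(1) finite_subset by blast
  have "measure \<nu> (A q) \<le> measure \<nu> (\<Union>n\<in>S. rect3 n)"
    using S(3) fin by (intro \<nu>.finite_measure_mono) (auto simp: A_def sets)
  then show ?thesis using that[of S] S fin q by (auto simp: I_def)
qed

text \<open>The order of the choices is decisive: \<open>\<nu>\<close> fixes \<open>H\<close> and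
  with it the constant at tiny scales, then comes the threshold \<open>\<rho>1\<close> below which
  the gap between \<open>t\<close> and \<open>t'\<close> absorbs that constant, then a distance
  \<open>d\<close> negligible against \<open>\<rho>1\<close>, and last the rectangles, small enough
  that no mass moves farther than \<open>d\<close>.\<close>

lemma refine:
  assumes \<nu>: "spread \<nu> G C m" and C: "0 < C0" "C0 \<le> C" "C < C'"
  obtains \<nu>' S where "finite S" "\<And>n. n \<in> S \<Longrightarrow> N \<le> n" "\<And>n. n \<in> S \<Longrightarrow> rect3 n \<subseteq> G"
    "spread \<nu>' (\<Union>n\<in>S. core n) C' m"
proof -
  have fm: "finite_measure \<nu>" and sets: "sets \<nu> = sets M"
    and "\<exists>H\<ge>0. \<forall>A\<in>sets M. measure \<nu> A \<le> H * measure M A"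
    and frost: "\<And>y \<rho>. y \<in> space M \<Longrightarrow> 0 < \<rho> \<Longrightarrow> measure \<nu> (cube y \<rho>) \<le> C * \<rho> powr t"
    using \<nu> unfolding spread_def by blast+
  then obtain H where H: "0 \<le> H" "\<And>A. A \<in> sets M \<Longrightarrow> measure \<nu> A \<le> H * measure M A" by blast
  interpret \<nu>: finite_measure \<nu> by (rule fm)
  let ?a = "a ^ CARD('p)" and ?b = "b ^ CARD('p)"
  \<comment> \<open>The product of the constants of \<open>density_on_box_bound\<close> and
    \<open>packing_bound\<close>.\<close>
  define K where "K = H * ?b * ?b / ?a * 3 powr \<Delta> * D * (?b / ?a * 4 powr \<Delta>)"
  obtain \<rho>1 where \<rho>1: "0 < \<rho>1" "\<rho>1 \<le> \<sigma>" "2 * \<rho>1 \<le> r0" "K * \<rho>1 powr (t' - t) \<le> C0"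
  proof -
    have "((\<lambda>\<rho>. K * \<rho> powr (t' - t)) \<longlongrightarrow> K * 0 powr (t' - t)) (at_right 0)"
      using t_less by (intro tendsto_intros tendsto_powr') (auto simp: eventually_at_filter)
    then have "eventually (\<lambda>\<rho>. K * \<rho> powr (t' - t) < C0) (at_right 0)"
      using C by (intro order_tendstoD(2)) auto
    moreover have "eventually (\<lambda>\<rho>. \<rho> < min \<sigma> (r0 / 2)) (at_right 0)"
      using \<sigma>_pos r0_pos by (intro order_tendstoD(2)[OF tendsto_ident_at]) auto
    moreover have "eventually (\<lambda>\<rho>::real. 0 < \<rho>) (at_right 0)"
      by (simp add: eventually_at_right_less)
    ultimately have "eventually (\<lambda>\<rho>. K * \<rho> powr (t' - t) < C0 \<and> \<rho> < min \<sigma> (r0 / 2) \<and> 0 < \<rho>) (at_right 0)"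
      by eventually_elim auto
    then obtain \<rho> where "K * \<rho> powr (t' - t) < C0 \<and> \<rho> < min \<sigma> (r0 / 2) \<and> 0 < \<rho>"
      using eventually_happens'[OF trivial_limit_at_right_real] by blast
    then show ?thesis by (intro that[of \<rho>]) auto
  qed
  \<comment> \<open>For \<open>\<rho> \<ge> \<rho>1\<close> enlarging a cube by \<open>d\<close>
    multiplies its radius by at most \<open>1 + d / \<rho>1\<close>; \<open>d\<close> is so small
    that this costs no more than the step from \<open>C\<close> to \<open>C'\<close>.\<close>
  obtain d where d: "0 < d" "C * (1 + d / \<rho>1) powr t \<le> C'"
  proof -
    have "((\<lambda>d. C * (1 + d / \<rho>1) powr t) \<longlongrightarrow> C * (1 + 0 / \<rho>1) powr t) (at_right 0)"
      using \<rho>1(1) by (intro tendsto_intros) auto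
    then have "eventually (\<lambda>d. C * (1 + d / \<rho>1) powr t < C') (at_right 0)"
      using C by (intro order_tendstoD(2)) auto
    then have "eventually (\<lambda>d. C * (1 + d / \<rho>1) powr t < C' \<and> 0 < d) (at_right 0)"
      using eventually_at_right_less[of "0::real"] by eventually_elim auto
    then obtain d where "C * (1 + d / \<rho>1) powr t < C' \<and> 0 < d"
      using eventually_happens'[OF trivial_limit_at_right_real] by blast
    then show ?thesis by (intro that[of d]) auto
  qed
  have "eventually (\<lambda>n. (\<forall>i. U n i < d / 4) \<and> (\<forall>i. U n i < r0 / 3) \<and> (\<forall>\<rho>. 0 < \<rho> \<and> \<rho> \<le> \<sigma> \<longrightarrow>
      (\<Prod>i\<in>UNIV. (max \<rho> (U n i) * min 1 (\<rho> / e n i)) powr \<delta> i) \<le> D * \<rho> powr t')) sequentially"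
    using content eventually_U_less[of "d / 4"] eventually_U_less[of "r0 / 3"] d(1) r0_pos
    by (simp add: eventually_conj_iff)
  then obtain N1 where N1: "\<And>n i. N1 \<le> n \<Longrightarrow> U n i < d / 4" "\<And>n i. N1 \<le> n \<Longrightarrow> U n i < r0 / 3"
    "\<And>n \<rho>. N1 \<le> n \<Longrightarrow> 0 < \<rho> \<Longrightarrow> \<rho> \<le> \<sigma> \<Longrightarrow>
      (\<Prod>i\<in>UNIV. (max \<rho> (U n i) * min 1 (\<rho> / e n i)) powr \<delta> i) \<le> D * \<rho> powr t'"
    unfolding eventually_sequentially by blast
  obtain S where S: "finite S" "disjoint_family_on rect S" "\<And>n. n \<in> S \<Longrightarrow> max N N1 \<le> n"
    "\<And>n. n \<in> S \<Longrightarrow> rect3 n \<subseteq> G" "m < measure \<nu> (\<Union>n\<in>S. rect3 n)"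
    using finite_selection[OF \<nu>, of "max N N1"] by blast
  \<comment> \<open>The cores are disjoint but their enlargements may overlap; giving each point to
    the first enlargement that contains it counts its mass once.\<close>
  define P where "P n = rect3 n - (\<Union>k\<in>S \<inter> {..<n}. rect3 k)" for n
  have P_sets: "P n \<in> sets \<nu>" for n
    unfolding P_def sets using S(1) by (intro sets.Diff sets.finite_UN) auto
  have P_sub: "P n \<subseteq> rect3 n" for n by (auto simp: P_def)
  have P_disj: "disjoint_family_on P S"
    unfolding disjoint_family_on_def
  proof (intro ballI impI)
    fix n k assume "n \<in> S" "k \<in> S" "n \<noteq> k"
    then show "P n \<inter> P k = {}" by (cases n k rule: linorder_cases) (auto simp: P_def)
  qed
  have P_Un: "(\<Union>n\<in>S. rect3 n) \<subseteq> (\<Union>n\<in>S. P n)"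
  proof
    fix z assume "z \<in> (\<Union>n\<in>S. rect3 n)"
    then have ex: "\<exists>n. n \<in> S \<and> z \<in> rect3 n" by blast
    define n where "n = (LEAST n. n \<in> S \<and> z \<in> rect3 n)"
    have "n \<in> S \<and> z \<in> rect3 n" unfolding n_def using ex by (rule LeastI_ex)
    moreover have "\<not> (k \<in> S \<and> z \<in> rect3 k)" if "k < n" for k
      using not_less_Least that unfolding n_def by blast
    ultimately show "z \<in> (\<Union>n\<in>S. P n)" by (auto simp: P_def)
  qed
  define w where "w n = measure \<nu> (P n)" for n
  have core_pos: "0 < measure M (core n)" if "n \<in> S" for n
  proof (rule box_pos)
    show "e n i \<le> r0" for i
      using N1(2)[of n i] S(3)[OF that] e_le[of n i] e_pos[of n i] by fastforce
  qed (use center e_pos in auto)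
  \<comment> \<open>The density that gives core \<open>n\<close> exactly the mass collected by
    \<open>P n\<close>.\<close>
  define q where "q n = w n / measure M (core n)" for n
  have q: "0 \<le> q n" for n unfolding q_def w_def by simp
  obtain \<nu>' where \<nu>': "sets \<nu>' = sets M" "finite_measure \<nu>'"
    "\<And>A. A \<in> sets M \<Longrightarrow> measure \<nu>' A = (\<Sum>n\<in>S. q n * measure M (core n \<inter> A))"
    using weighted_restriction[OF S(1), of q core] q by auto
  have le_w: "q n * measure M (core n \<inter> A) \<le> w n" if "n \<in> S" "A \<in> sets M" for n A
  proof -
    have "q n * measure M (core n \<inter> A) \<le> q n * measure M (core n)"
      using q that by (intro mult_left_mono product.finite_measure_mono) auto
    also have "\<dots> = w n" using core_pos[OF that(1)] by (simp add: q_def)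
    finally show ?thesis .
  qed
  have sum_w: "(\<Sum>n\<in>T. w n) = measure \<nu> (\<Union>n\<in>T. P n)" if "T \<subseteq> S" for T
    unfolding w_def
    by (rule \<nu>.finite_measure_finite_Union[symmetric])
      (use that S(1) P_sets P_disj in \<open>auto intro: finite_subset disjoint_family_on_mono\<close>)
  have large: "measure \<nu>' (cube y \<rho>) \<le> C' * \<rho> powr t" if y: "y \<in> space M" and \<rho>: "\<rho>1 \<le> \<rho>" for y \<rho>
  proof -
    have \<rho>0: "0 < \<rho>" using \<rho> \<rho>1(1) by linarith
    define T where "T = {n\<in>S. core n \<inter> cube y \<rho> \<noteq> {}}"
    have "measure \<nu>' (cube y \<rho>) = (\<Sum>n\<in>T. q n * measure M (core n \<inter> cube y \<rho>))"
      unfolding \<nu>'(3)[OF sets_box] using S(1) by (intro sum.mono_neutral_right) (auto simp: T_def)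
    also have "\<dots> \<le> (\<Sum>n\<in>T. w n)" by (intro sum_mono le_w) (auto simp: T_def)
    also have "\<dots> = measure \<nu> (\<Union>n\<in>T. P n)" by (rule sum_w) (auto simp: T_def)
    \<comment> \<open>If a core meets the cube, points of its enlargement miss the cube by less than
      \<open>e + 3 * U\<close>, which is below \<open>4 * U\<close> and so below
      \<open>d\<close>.\<close>
    also have "\<dots> \<le> measure \<nu> (cube y (\<rho> + d))"
    proof (rule \<nu>.finite_measure_mono)
      show "(\<Union>n\<in>T. P n) \<subseteq> cube y (\<rho> + d)"
      proof
        fix z assume "z \<in> (\<Union>n\<in>T. P n)"
        then obtain n where n: "n \<in> S" "core n \<inter> cube y \<rho> \<noteq> {}" "z \<in> rect3 n"
          using P_sub by (auto simp: T_def)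
        then obtain k where k: "k \<in> core n" "k \<in> cube y \<rho>" by blast
        have "dist (y i) (z i) < \<rho> + d" for i
        proof -
          have "dist (y i) (z i) \<le> dist (y i) (k i) + dist (c n i) (k i) + dist (c n i) (z i)"
            by metric
          also have "\<dots> < \<rho> + e n i + 3 * U n i"
            using k n(3) unfolding mem_box by (intro add_strict_mono) auto
          also have "\<dots> \<le> \<rho> + d"
            using N1(1)[of n i] S(3)[OF n(1)] e_le[of n i] e_pos[of n i] by fastforce
          finally show ?thesis .
        qed
        then show "z \<in> cube y (\<rho> + d)" using n(3) by (simp add: mem_box)
      qed
    qed (simp add: sets)
    also have "\<dots> \<le> C * (\<rho> + d) powr t" using frost y \<rho>0 d(1) by simp
    also have "\<rho> + d \<le> (1 + d / \<rho>1) * \<rho>"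
      using mult_left_mono[OF \<rho>, of d] \<rho>1(1) d(1) by (simp add: field_simps)
    then have "C * (\<rho> + d) powr t \<le> C * ((1 + d / \<rho>1) * \<rho>) powr t"
      using C \<rho>0 d(1) t_nonneg by (intro mult_left_mono powr_mono2) auto
    also have "\<dots> = C * (1 + d / \<rho>1) powr t * \<rho> powr t"
      using \<rho>0 \<rho>1(1) d(1) by (simp add: powr_mult)
    also have "\<dots> \<le> C' * \<rho> powr t" using d(2) by (intro mult_right_mono) auto
    finally show ?thesis .
  qed
  have small: "measure \<nu>' (cube y \<rho>) \<le> C' * \<rho> powr t" if y: "y \<in> space M" and \<rho>: "0 < \<rho>" "\<rho> \<le> \<rho>1" for y \<rho>
  proof -
    define T where "T = {n\<in>S. core n \<inter> cube y \<rho> \<noteq> {}}"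
    have TS: "T \<subseteq> S" by (auto simp: T_def)
    have y': "y i \<in> X i" for i using y by (simp add: mem_space)
    have "measure \<nu>' (cube y \<rho>) = (\<Sum>n\<in>T. q n * measure M (core n \<inter> cube y \<rho>))"
      unfolding \<nu>'(3)[OF sets_box] using S(1) by (intro sum.mono_neutral_right) (auto simp: T_def)
    also have "\<dots> \<le> (\<Sum>n\<in>T. H * ?b * ?b / ?a * 3 powr \<Delta> * D * \<rho> powr (t' - \<Delta>)
       * (\<Prod>i\<in>UNIV. min \<rho> (U n i) powr \<delta> i))"
      unfolding q_def
    proof (intro sum_mono density_on_box_bound)
      fix n assume "n \<in> T"
      then have n: "n \<in> S" "N1 \<le> n" using S(3) by (auto simp: T_def)
      show "w n \<le> H * measure M (rect3 n)"
      proof -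
        have "w n \<le> measure \<nu> (rect3 n)"
          unfolding w_def using P_sub by (intro \<nu>.finite_measure_mono) (auto simp: sets)
        also have "\<dots> \<le> H * measure M (rect3 n)" by (rule H(2)) simp
        finally show ?thesis .
      qed
      show "3 * U n i \<le> r0" for i using N1(2)[OF n(2), of i] by simp
      show "(\<Prod>i\<in>UNIV. (max \<rho> (U n i) * min 1 (\<rho> / e n i)) powr \<delta> i) \<le> D * \<rho> powr t'"
        using N1(3)[OF n(2)] \<rho> \<rho>1 by simp
    qed (use H center y' e_pos e_le \<rho> \<rho>1 in \<open>auto simp: w_def\<close>)
    also have "\<dots> = H * ?b * ?b / ?a * 3 powr \<Delta> * D * \<rho> powr (t' - \<Delta>)
        * (\<Sum>n\<in>T. \<Prod>i\<in>UNIV. min \<rho> (U n i) powr \<delta> i)"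
      by (simp add: sum_distrib_left)
    also have "\<dots> \<le> H * ?b * ?b / ?a * 3 powr \<Delta> * D * \<rho> powr (t' - \<Delta>) * (?b / ?a * 4 powr \<Delta> * \<rho> powr \<Delta>)"
    proof (intro mult_left_mono packing_bound[where y = y and c = c and e = e])
      show "disjoint_family_on rect T" using S(2) TS by (rule disjoint_family_on_mono[rotated])
    qed (use S(1) TS center y' U_pos e_le \<rho> \<rho>1 H a_pos b_pos D_pos in
        \<open>auto simp: T_def intro!: mult_nonneg_nonneg divide_nonneg_nonneg\<close>)
    also have "\<dots> = K * (\<rho> powr (t' - \<Delta>) * \<rho> powr \<Delta>)" by (simp add: K_def)
    also have "\<rho> powr (t' - \<Delta>) * \<rho> powr \<Delta> = \<rho> powr (t' - t) * \<rho> powr t"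
      by (simp add: powr_add[symmetric])
    \<comment> \<open>Here the gap is spent: \<open>t' - t\<close> is positive, so the choice of
      \<open>\<rho>1\<close> bounds \<open>K * \<rho> powr (t' - t)\<close> by \<open>C0\<close> at
      every smaller scale, however large \<open>H\<close> is.\<close>
    also have "K * (\<rho> powr (t' - t) * \<rho> powr t) \<le> K * (\<rho>1 powr (t' - t) * \<rho> powr t)"
      using \<rho> t_less H a_pos b_pos D_pos unfolding K_def
      by (intro mult_left_mono mult_right_mono powr_mono2) auto
    also have "\<dots> \<le> C0 * \<rho> powr t"
      using mult_right_mono[OF \<rho>1(4), of "\<rho> powr t"] by (simp add: mult.assoc)
    also have "\<dots> \<le> C' * \<rho> powr t" using C by (intro mult_right_mono) auto
    finally show ?thesis .
  qed
  have "spread \<nu>' (\<Union>n\<in>S. core n) C' m"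
    unfolding spread_def
  proof (intro conjI)
    show "(\<Union>n\<in>S. core n) \<in> sets M" using S(1) by auto
    then show "measure \<nu>' (space M - (\<Union>n\<in>S. core n)) = 0"
    proof (subst \<nu>'(3))
      have "core n \<inter> (space M - \<Union> (core ` S)) = {}" if "n \<in> S" for n using that by blast
      then show "(\<Sum>n\<in>S. q n * measure M (core n \<inter> (space M - \<Union> (core ` S)))) = 0"
        by simp
    qed auto
    show "\<exists>H\<ge>0. \<forall>A\<in>sets M. measure \<nu>' A \<le> H * measure M A"
    proof (intro exI[of _ "\<Sum>n\<in>S. q n"] conjI ballI)
      fix A assume A: "A \<in> sets M"
      show "measure \<nu>' A \<le> (\<Sum>n\<in>S. q n) * measure M A"
        unfolding \<nu>'(3)[OF A] sum_distrib_right
        using q A by (intro sum_mono mult_left_mono product.finite_measure_mono) auto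
    qed (use q in \<open>auto intro: sum_nonneg\<close>)
    show "\<forall>z\<in>\<Union> (core ` S). \<exists>\<eta>>0. cube z \<eta> \<subseteq> \<Union> (core ` S)"
    proof
      fix z assume "z \<in> \<Union> (core ` S)"
      then obtain n where n: "n \<in> S" "z \<in> core n" by blast
      then obtain \<eta> where "0 < \<eta>" "cube z \<eta> \<subseteq> core n" using box_relopen[OF n(2)] e_pos by blast
      then show "\<exists>\<eta>>0. cube z \<eta> \<subseteq> \<Union> (core ` S)" using n(1) by blast
    qed
    show "\<forall>y \<rho>. y \<in> space M \<longrightarrow> 0 < \<rho> \<longrightarrow> measure \<nu>' (cube y \<rho>) \<le> C' * \<rho> powr t"
      using large small by (meson linear)
    have "measure \<nu>' (space M) = (\<Sum>n\<in>S. q n * measure M (core n))"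
      unfolding \<nu>'(3)[OF sets.top] by (intro sum.cong refl arg_cong2[of _ _ _ _ "(*)"] arg_cong[of _ _ "measure M"])
        (auto simp: mem_box mem_space)
    also have "\<dots> = (\<Sum>n\<in>S. w n)"
      using core_pos by (intro sum.cong) (auto simp: q_def less_imp_neq[THEN not_sym])
    also have "\<dots> = measure \<nu> (\<Union>n\<in>S. P n)" by (rule sum_w) simp
    also have "measure \<nu> (\<Union>n\<in>S. rect3 n) \<le> measure \<nu> (\<Union>n\<in>S. P n)"
      using P_Un P_sets S(1) by (intro \<nu>.finite_measure_mono) auto
    finally show "m < measure \<nu>' (space M)" using S(5) by simp
  qed (use \<nu>' in auto)
  then show ?thesis using that S by auto
qed

end

subsection \<open>Nested compact sets and Hausdorff measure\<close>

context rectangle_family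
begin

text \<open>Closed balls, for compactness; \<open>2 * e n i \<le> U n i\<close> still keeps them
  inside the enlargements.\<close>

definition closed_core :: "nat \<Rightarrow> ('p \<Rightarrow> 'a) set" where
  "closed_core n = {z. \<forall>i. z i \<in> X i \<and> dist (c n i) (z i) \<le> e n i}"

lemma core_subset_closed_core: "core n \<subseteq> closed_core n"
  by (auto simp: closed_core_def mem_box less_imp_le)

lemma closed_core_subset_rect3: "closed_core n \<subseteq> rect3 n"
proof
  fix z assume z: "z \<in> closed_core n"
  have "dist (c n i) (z i) < 3 * U n i" for i
    using z e_pos[of n i] e_le[of n i] unfolding closed_core_def by (smt (verit) mem_Collect_eq)
  then show "z \<in> rect3 n" using z by (simp add: mem_box closed_core_def)
qed

text \<open>The \<open>X i\<close> need not be closed, so compactness has to be inherited from a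
  compact \<open>F\<close> around the core; the nesting supplies it.\<close>

lemma compact_closed_core:
  assumes "closed_core n \<subseteq> F" "F \<subseteq> space M" "compact F"
  shows "compact (closed_core n)"
proof -
  have "closed {z. \<forall>i. dist (c n i) (z i) \<le> e n i}"
    by (intro closed_Collect_all closed_Collect_le continuous_intros continuous_on_product_coordinates)
  moreover have "closed_core n = F \<inter> {z. \<forall>i. dist (c n i) (z i) \<le> e n i}"
    using assms by (auto simp: closed_core_def mem_space)
  ultimately show ?thesis using assms(3) by (simp add: compact_Int_closed)
qed

text \<open>For a rectangle finer than the cube every factor of the content product collapses to
  \<open>\<rho>\<close>, so \<open>content\<close> yields
  \<open>\<rho> powr \<Delta> \<le> D * \<rho> powr t'\<close>. For large \<open>\<rho>\<close>
  total mass 1 suffices.\<close>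

lemma cube_frostman:
  obtains C where "0 < C" "\<And>y \<rho>. y \<in> space M \<Longrightarrow> 0 < \<rho> \<Longrightarrow> measure M (cube y \<rho>) \<le> C * \<rho> powr t"
proof
  define \<rho>0 where "\<rho>0 = min (min \<sigma> 1) r0"
  have \<rho>0: "0 < \<rho>0" "\<rho>0 \<le> \<sigma>" "\<rho>0 \<le> 1" "\<rho>0 \<le> r0" using \<sigma>_pos r0_pos by (auto simp: \<rho>0_def)
  let ?b = "b ^ CARD('p)"
  show "0 < ?b * D + \<rho>0 powr (- t)" using b_pos D_pos \<rho>0 by (intro add_pos_pos) auto
  fix y \<rho> assume y: "y \<in> space M" and \<rho>: "0 < (\<rho>::real)"
  show "measure M (cube y \<rho>) \<le> (?b * D + \<rho>0 powr (- t)) * \<rho> powr t"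
  proof (cases "\<rho> \<le> \<rho>0")
    case True
    have "eventually (\<lambda>n. (\<forall>i. U n i < \<rho>) \<and>
      (\<Prod>i\<in>UNIV. (max \<rho> (U n i) * min 1 (\<rho> / e n i)) powr \<delta> i) \<le> D * \<rho> powr t') sequentially"
      using eventually_U_less[OF \<rho>] content by eventually_elim (use True \<rho> \<rho>0 in auto)
    then obtain n where n: "\<And>i. U n i < \<rho>"
      "(\<Prod>i\<in>UNIV. (max \<rho> (U n i) * min 1 (\<rho> / e n i)) powr \<delta> i) \<le> D * \<rho> powr t'"
      using eventually_happens'[OF sequentially_bot] by blast
    have "max \<rho> (U n i) * min 1 (\<rho> / e n i) = \<rho>" for i
      using n(1)[of i] e_le[of n i] e_pos[of n i] by (simp add: max_def min_def)
    then have "\<rho> powr \<Delta> \<le> D * \<rho> powr t'" using n(2) \<rho> by (simp add: powr_sum)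
    also have "\<dots> \<le> D * \<rho> powr t"
      using True \<rho> \<rho>0 D_pos t_less by (intro mult_left_mono powr_mono') auto
    finally have *: "\<rho> powr \<Delta> \<le> D * \<rho> powr t" .
    have "measure M (cube y \<rho>) \<le> ?b * \<rho> powr \<Delta>"
      using box_upper[of y "\<lambda>_. \<rho>"] y \<rho> True \<rho>0 by (simp add: mem_space powr_sum)
    also have "\<dots> \<le> ?b * (D * \<rho> powr t)" using * b_pos by (intro mult_left_mono) auto
    also have "\<dots> \<le> (?b * D + \<rho>0 powr (- t)) * \<rho> powr t" by (simp add: algebra_simps)
    finally show ?thesis .
  next
    case False
    have "1 \<le> (\<rho> / \<rho>0) powr t" using False \<rho>0 t_nonneg by (intro ge_one_powr_ge_zero) auto
    also have "\<dots> = \<rho>0 powr (- t) * \<rho> powr t"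
      using \<rho> \<rho>0 by (simp add: powr_divide powr_minus_divide)
    also have "\<dots> \<le> (?b * D + \<rho>0 powr (- t)) * \<rho> powr t"
      using b_pos D_pos by (simp add: algebra_simps)
    finally show ?thesis using product.prob_le_1[of "cube y \<rho>"] by linarith
  qed
qed

lemma initial_spread:
  assumes lc: "\<And>i. locally compact (X i)"
  obtains \<nu> G F C m where "spread \<nu> G C m" "0 < C" "0 < m" "G \<subseteq> F" "compact F" "F \<subseteq> space M"
proof -
  define z where "z = c 0"
  have z: "z i \<in> X i" for i by (simp add: z_def center)
  have "\<forall>i. \<exists>\<epsilon>>0. closed (cball (z i) \<epsilon> \<inter> X i)"
    using lc z locally_compact_Int_cball by blast
  then obtain \<epsilon> where \<epsilon>: "\<And>i. 0 < \<epsilon> i" "\<And>i. closed (cball (z i) (\<epsilon> i) \<inter> X i)" by metis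
  \<comment> \<open>Small enough for the lower measure bound at radius \<open>\<epsilon>0\<close>
    and for the cube to stay inside the compact product of closed balls.\<close>
  define \<epsilon>0 where "\<epsilon>0 = min r0 (Min (range \<epsilon>))"
  have \<epsilon>0: "0 < \<epsilon>0" "\<epsilon>0 \<le> r0" "\<epsilon>0 \<le> \<epsilon> i" for i
    using \<epsilon>(1) r0_pos by (auto simp: \<epsilon>0_def min_le_iff_disj)
  define F where "F = PiE UNIV (\<lambda>i. cball (z i) (\<epsilon> i) \<inter> X i)"
  have "compactin (product_topology (\<lambda>_. euclidean) UNIV) F"
    unfolding F_def compactin_PiE compactin_euclidean_iff
    using \<epsilon>(2) by (auto simp: compact_eq_bounded_closed bounded_Int)
  then have F: "compact F" by (simp add: euclidean_product_topology)
  have FM: "F \<subseteq> space M" by (auto simp: F_def space_M)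
  define G where "G = cube z \<epsilon>0"
  have GF: "G \<subseteq> F"
  proof
    fix q assume "q \<in> G"
    then have "q i \<in> X i" "dist (z i) (q i) \<le> \<epsilon> i" for i
      using \<epsilon>0(3)[of i] by (auto simp: G_def mem_box intro: order.strict_implies_order less_le_trans)
    then show "q \<in> F" by (simp add: F_def PiE_iff)
  qed
  have pos: "0 < measure M G" unfolding G_def using z \<epsilon>0 by (intro box_pos)
  obtain C where C: "0 < C" "\<And>y \<rho>. y \<in> space M \<Longrightarrow> 0 < \<rho> \<Longrightarrow> measure M (cube y \<rho>) \<le> C * \<rho> powr t"
    by (rule cube_frostman) blast
  obtain \<nu> where \<nu>: "sets \<nu> = sets M" "finite_measure \<nu>"
    "\<And>A. A \<in> sets M \<Longrightarrow> measure \<nu> A = (\<Sum>n\<in>{()}. 1 * measure M (G \<inter> A))"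
    using weighted_restriction[of "{()}" "\<lambda>_. 1" "\<lambda>_. G"] by (auto simp: G_def)
  then have \<nu>': "measure \<nu> A = measure M (G \<inter> A)" if "A \<in> sets M" for A using that by simp
  have le: "measure \<nu> A \<le> measure M A" if "A \<in> sets M" for A
    unfolding \<nu>'[OF that] using that by (intro product.finite_measure_mono) auto
  have G: "G \<in> sets M" by (simp add: G_def)
  have "spread \<nu> G C (measure M G / 2)"
    unfolding spread_def
  proof (intro conjI)
    show "measure \<nu> (space M - G) = 0" using G by (subst \<nu>') auto
    show "\<exists>H\<ge>0. \<forall>A\<in>sets M. measure \<nu> A \<le> H * measure M A"
      using le by (intro exI[of _ 1]) auto
    show "\<forall>z\<in>G. \<exists>\<eta>>0. cube z \<eta> \<subseteq> G" unfolding G_def using \<epsilon>0(1) by (blast intro: box_relopen)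
    show "\<forall>y \<rho>. y \<in> space M \<longrightarrow> 0 < \<rho> \<longrightarrow> measure \<nu> (cube y \<rho>) \<le> C * \<rho> powr t"
      using le[OF sets_box] C(2) order_trans by blast
    have "G \<inter> space M = G" using GF FM by blast
    then show "measure M G / 2 < measure \<nu> (space M)" using pos by (simp add: \<nu>')
  qed (use \<nu> G in auto)
  then show ?thesis using that C(1) pos GF F FM by (metis half_gt_zero)
qed

text \<open>Iterating \<open>refine\<close> by dependent choice. Step \<open>j\<close> uses only
  indices from \<open>j\<close> on, so the intersection of the \<open>F j\<close> lies in the limsup
  of the closed cores, while \<open>C\<close> and \<open>m\<close> stay the same for all
  \<open>j\<close>.\<close>

lemma nested_compacts:
  assumes lc: "\<And>i. locally compact (X i)"
  obtains F G \<nu> C m where "0 < C" "0 < m"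
    "\<And>j. compact (F j)" "\<And>j. F (Suc j) \<subseteq> F j" "\<And>j. F j \<subseteq> space M"
    "\<And>j. F (Suc j) \<subseteq> (\<Union>n\<in>{j..}. closed_core n)"
    "\<And>j. G j \<subseteq> F j" "\<And>j. spread (\<nu> j) (G j) C m"
proof -
  obtain \<nu>0 G0 F0 C0 m where init: "spread \<nu>0 G0 C0 m" "0 < C0" "0 < m" "G0 \<subseteq> F0" "compact F0"
    "F0 \<subseteq> space M"
    using initial_spread[OF lc] .
  \<comment> \<open>Strictly increasing, as \<open>refine\<close> demands, yet starting at
    \<open>C0\<close> and staying below \<open>2 * C0\<close>.\<close>
  define CC where "CC j = C0 * (2 - (1/2) ^ j)" for j :: nat
  define P where "P j = (\<lambda>(\<nu>, G, F). spread \<nu> G (CC j) m \<and> G \<subseteq> F \<and> compact F \<and> F \<subseteq> space M)" for j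
  define Q where "Q j = (\<lambda>(\<nu> :: ('p \<Rightarrow> 'a) measure, G :: ('p \<Rightarrow> 'a) set, F) (\<nu>' :: ('p \<Rightarrow> 'a) measure, G' :: ('p \<Rightarrow> 'a) set, F').
    F' \<subseteq> F \<and> F' \<subseteq> (\<Union>n\<in>{j..}. closed_core n))" for j :: nat
  have "\<exists>f. \<forall>j. P j (f j) \<and> Q j (f j) (f (Suc j))"
  proof (rule dependent_nat_choice)
    show "\<exists>s. P 0 s" using init by (intro exI[of _ "(\<nu>0, G0, F0)"]) (simp add: P_def CC_def)
  next
    fix s j assume s: "P j s"
    obtain \<nu> G F where s_eq: "s = (\<nu>, G, F)" by (cases s)
    have \<nu>: "spread \<nu> G (CC j) m" and F: "G \<subseteq> F" "compact F" "F \<subseteq> space M"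
      using s by (auto simp: P_def s_eq)
    have CC: "C0 \<le> CC j" "CC j < CC (Suc j)"
      using init(2) by (auto simp: CC_def power_le_one)
    obtain \<nu>' S where S: "finite S" "\<And>n. n \<in> S \<Longrightarrow> j \<le> n" "\<And>n. n \<in> S \<Longrightarrow> rect3 n \<subseteq> G"
      "spread \<nu>' (\<Union>n\<in>S. core n) (CC (Suc j)) m"
      by (rule refine[OF \<nu> init(2) CC, where N = j]) (rule that; assumption)
    define F' where "F' = (\<Union>n\<in>S. closed_core n)"
    have sub: "closed_core n \<subseteq> F" if "n \<in> S" for n
      using closed_core_subset_rect3[of n] S(3)[OF that] F(1) by blast
    have "compact F'" unfolding F'_def using S(1) sub F by (intro compact_UN compact_closed_core)
    moreover have "F' \<subseteq> F" using sub by (auto simp: F'_def)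
    moreover have "(\<Union>n\<in>S. core n) \<subseteq> F'" using core_subset_closed_core by (auto simp: F'_def)
    ultimately have "P (Suc j) (\<nu>', \<Union>n\<in>S. core n, F') \<and> Q j s (\<nu>', \<Union>n\<in>S. core n, F')"
      using S(2,4) F(3) by (fastforce simp: P_def Q_def s_eq F'_def)
    then show "\<exists>s'. P (Suc j) s' \<and> Q j s s'" by blast
  qed
  then obtain f where f: "\<And>j. P j (f j)" "\<And>j. Q j (f j) (f (Suc j))" by blast
  define \<nu> where "\<nu> j = fst (f j)" for j
  define G where "G j = fst (snd (f j))" for j
  define F where "F j = snd (snd (f j))" for j
  have f_eq: "f j = (\<nu> j, G j, F j)" for j by (simp add: \<nu>_def G_def F_def)
  have "spread (\<nu> j) (G j) (2 * C0) m" for j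
  proof -
    have "CC j \<le> 2 * C0" using init(2) by (simp add: CC_def)
    then have "CC j * \<rho> powr t \<le> 2 * C0 * \<rho> powr t" for \<rho> by (intro mult_right_mono) auto
    moreover have "spread (\<nu> j) (G j) (CC j) m" using f(1)[of j] by (simp add: P_def f_eq)
    ultimately show ?thesis unfolding spread_def by (blast intro: order_trans)
  qed
  then show ?thesis
    using f init(2,3) by (intro that[of "2 * C0" m F G \<nu>]) (auto simp: P_def Q_def f_eq split: prod.splits)
qed

section \<open>From nested compact sets to lower bounds for covers\<close>

lemma limsup_closed_core_subset: "limsup closed_core \<subseteq> space M"
  unfolding limsup_INF_SUP by (auto simp: closed_core_def mem_space)

text \<open>By compactness a cover of the intersection already covers some \<open>F j\<close>, and
  finitely many cubes suffice for it. The Frostman bound of \<open>\<nu> j\<close> then gives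
  \<open>\<kappa> = m / C\<close>, which depends neither on \<open>j\<close> nor on the
  cover.\<close>

lemma cover_bound:
  assumes lc: "\<And>i. locally compact (X i)"
  obtains \<kappa> where "0 < \<kappa>"
    "\<And>(I :: nat set) y \<rho>. (\<And>k. k \<in> I \<Longrightarrow> y k \<in> space M \<and> 0 < \<rho> k) \<Longrightarrow>
       limsup closed_core \<subseteq> (\<Union>k\<in>I. cube (y k) (\<rho> k)) \<Longrightarrow>
       \<exists>J\<subseteq>I. finite J \<and> \<kappa> \<le> (\<Sum>k\<in>J. \<rho> k powr t)"
proof -
  obtain F G \<nu> C m where C: "0 < C" and m: "0 < m"
    and F: "\<And>j. compact (F j)" "\<And>j. F (Suc j) \<subseteq> F j" "\<And>j. F j \<subseteq> space M"
      "\<And>j. F (Suc j) \<subseteq> (\<Union>n\<in>{j..}. closed_core n)"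
    and G: "\<And>j. G j \<subseteq> F j" and \<nu>: "\<And>j. spread (\<nu> j) (G j) C m"
    by (rule nested_compacts[OF lc]) (rule that; assumption)
  have "\<exists>J\<subseteq>I. finite J \<and> m / C \<le> (\<Sum>k\<in>J. \<rho> k powr t)"
    if y: "\<And>k. k \<in> I \<Longrightarrow> y k \<in> space M \<and> 0 < \<rho> k"
      and cover: "limsup closed_core \<subseteq> (\<Union>k\<in>I. cube (y k) (\<rho> k))" for I :: "nat set" and y \<rho>
  proof -
    \<comment> \<open>The cubes are open only relative to the product of the \<open>X i\<close>;
      \<open>W k\<close> is the open set of the whole function space that cuts out the cube.\<close>
    define W where "W k = {z. \<forall>i. dist (y k i) (z i) < \<rho> k}" for k
    have W: "open (W k)" for k
    proof -
      have "W k = PiE UNIV (\<lambda>i. ball (y k i) (\<rho> k))" by (auto simp: W_def)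
      then show ?thesis by (simp add: open_PiE)
    qed
    have cube_W: "cube (y k) (\<rho> k) = W k \<inter> space M" for k by (auto simp: W_def mem_box mem_space)
    have anti: "decseq F" using F(2) by (rule decseq_SucI)
    have "(\<Inter>j. F j) \<subseteq> limsup closed_core"
      unfolding limsup_INF_SUP using F(4) by blast
    also have "\<dots> \<subseteq> (\<Union>k\<in>I. W k)"
      by (rule subset_trans[OF cover UN_mono]) (simp_all add: cube_W)
    finally have empty: "(\<Inter>j. F j - (\<Union>k\<in>I. W k)) = {}" by auto
    have "\<exists>j. F j \<subseteq> (\<Union>k\<in>I. W k)"
    proof (rule ccontr)
      assume *: "\<not> ?thesis"
      have cpt: "compact (F j - (\<Union>k\<in>I. W k))" for j
        using F(1) W by (intro compact_diff) auto
      \<comment> \<open>If no \<open>F j\<close> were covered, the uncovered parts would be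
        decreasing nonempty compact sets, with a common point in the intersection.\<close>
      have "(F 0 - (\<Union>k\<in>I. W k)) \<inter> (\<Inter>j\<in>UNIV. F j - (\<Union>k\<in>I. W k)) \<noteq> {}"
      proof (rule compact_imp_fip_image[OF cpt])
        fix T :: "nat set" assume T: "finite T"
        define q where "q = Max (insert 0 T)"
        have "F q \<subseteq> F j" if "j \<in> insert 0 T" for j
          using anti T that unfolding decseq_def q_def by (metis Max_ge finite.insertI)
        moreover obtain z where "z \<in> F q - (\<Union>k\<in>I. W k)" using * by blast
        ultimately show "(F 0 - (\<Union>k\<in>I. W k)) \<inter> (\<Inter>j\<in>T. F j - (\<Union>k\<in>I. W k)) \<noteq> {}" by blast
      qed (use cpt in \<open>auto intro: compact_imp_closed\<close>)
      then show False using empty by blast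
    qed
    then obtain j where j: "F j \<subseteq> (\<Union>k\<in>I. W k)" by blast
    obtain J where J: "J \<subseteq> I" "finite J" "F j \<subseteq> (\<Union>k\<in>J. W k)"
      using compactE_image[OF F(1), of I W j] W j by metis
    have sets: "sets (\<nu> j) = sets M" and mass: "m < measure (\<nu> j) (space M)"
      and Gj: "G j \<in> sets M" "measure (\<nu> j) (space M - G j) = 0" and fm: "finite_measure (\<nu> j)"
      and frost: "\<And>y \<rho>. y \<in> space M \<Longrightarrow> 0 < \<rho> \<Longrightarrow> measure (\<nu> j) (cube y \<rho>) \<le> C * \<rho> powr t"
      using \<nu>[of j] unfolding spread_def by blast+
    interpret \<nu>: finite_measure "\<nu> j" by (rule fm)
    have "space M = G j \<union> (space M - G j)" using G F(3) by blast
    then have "measure (\<nu> j) (space M) \<le> measure (\<nu> j) (G j) + measure (\<nu> j) (space M - G j)"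
      using measure_Un_le[of "G j" "\<nu> j" "space M - G j"] Gj(1) by (simp add: sets)
    then have "m \<le> measure (\<nu> j) (G j)" using mass Gj(2) by simp
    also have "\<dots> \<le> measure (\<nu> j) (\<Union>k\<in>J. cube (y k) (\<rho> k))"
    proof (rule \<nu>.finite_measure_mono)
      show "G j \<subseteq> (\<Union>k\<in>J. cube (y k) (\<rho> k))" using J(3) G[of j] F(3)[of j] unfolding cube_W by blast
    qed (use J in \<open>auto simp: sets\<close>)
    also have "\<dots> \<le> (\<Sum>k\<in>J. measure (\<nu> j) (cube (y k) (\<rho> k)))"
      using J(2) by (intro \<nu>.finite_measure_subadditive_finite) (auto simp: sets)
    also have "\<dots> \<le> (\<Sum>k\<in>J. C * \<rho> k powr t)" using y J(1) by (intro sum_mono frost) auto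
    finally have "m / C \<le> (\<Sum>k\<in>J. \<rho> k powr t)"
      using C by (simp add: sum_distrib_left[symmetric] pos_divide_le_eq mult.commute)
    then show ?thesis using J by blast
  qed
  then show ?thesis using that[of "m / C"] C m by auto
qed

end

text \<open>Cubes are open, so the radius must exceed the diameter strictly, which may be 0; right
  continuity of the power keeps the extra cost below \<open>\<eta>\<close>. For \<open>t = 0\<close>
  every radius costs 1.\<close>

lemma gauge_enlarge:
  assumes "0 \<le> t" "0 < \<eta>" "bounded U"
  obtains \<rho> where "diameter U < \<rho>" "ennreal (\<rho> powr t) \<le> hausdorff_gauge t U + ennreal \<eta> \<or> U = {}" "0 < \<rho>"
proof (cases "t = 0")
  case True
  then show ?thesis using diameter_ge_0[OF assms(3)] by (intro that[of "diameter U + 1"]) (auto simp: hausdorff_gauge_def)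
next
  case False
  let ?d = "diameter U"
  have d: "0 \<le> ?d" by (rule diameter_ge_0[OF assms(3)])
  have "((\<lambda>\<rho>. \<rho> powr t) \<longlongrightarrow> ?d powr t) (at_right ?d)"
    using d False assms(1) by (intro tendsto_powr' tendsto_intros) (auto simp: eventually_at_filter)
  then have "eventually (\<lambda>\<rho>. \<rho> powr t < ?d powr t + \<eta>) (at_right ?d)"
    using assms(2) by (intro order_tendstoD(2)) auto
  then have "eventually (\<lambda>\<rho>. \<rho> powr t < ?d powr t + \<eta> \<and> ?d < \<rho>) (at_right ?d)"
    using eventually_at_right_less[of ?d] by eventually_elim auto
  then obtain \<rho> where \<rho>: "\<rho> powr t < ?d powr t + \<eta>" "?d < \<rho>"
    using eventually_happens'[OF trivial_limit_at_right_real] by blast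
  have "ennreal (\<rho> powr t) \<le> ennreal (?d powr t) + ennreal \<eta>"
    using \<rho>(1) assms(2) by (simp flip: ennreal_plus add: ennreal_leI)
  then show ?thesis using \<rho> d False by (intro that[of \<rho>]) (auto simp: hausdorff_gauge_def)
qed

lemma (in rectangle_family) hausdorff_measure_pos:
  assumes lc: "\<And>i. locally compact (X i)" and sub: "limsup closed_core \<subseteq> A"
  shows "hausdorff_measure t (vec_lambda ` A :: ('a, 'p) vec set) \<noteq> 0"
proof -
  obtain \<kappa> where \<kappa>: "0 < \<kappa>"
    "\<And>(I :: nat set) y \<rho>. (\<And>k. k \<in> I \<Longrightarrow> y k \<in> space M \<and> 0 < \<rho> k) \<Longrightarrow>
       limsup closed_core \<subseteq> (\<Union>k\<in>I. cube (y k) (\<rho> k)) \<Longrightarrow>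
       \<exists>J\<subseteq>I. finite J \<and> \<kappa> \<le> (\<Sum>k\<in>J. \<rho> k powr t)"
    using cover_bound[OF lc] by blast
  have "ennreal (\<kappa> / 2) \<le> (\<Sum>k. hausdorff_gauge t (V k))"
    if V: "\<And>k. bounded (V k)" and cov: "vec_lambda ` A \<subseteq> (\<Union>k. V k)" for V :: "nat \<Rightarrow> ('a, 'p) vec set"
  proof -
    \<comment> \<open>Sets that miss the limsup of the closed cores are dropped; each remaining one
      supplies a centre for its cube.\<close>
    define I where "I = {k. \<exists>z\<in>limsup closed_core. vec_lambda z \<in> V k}"
    have "\<exists>y. k \<in> I \<longrightarrow> y \<in> limsup closed_core \<and> vec_lambda y \<in> V k" for k by (auto simp: I_def)
    then obtain y where y: "\<And>k. k \<in> I \<Longrightarrow> y k \<in> limsup closed_core" "\<And>k. k \<in> I \<Longrightarrow> vec_lambda (y k) \<in> V k"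
      by metis
    \<comment> \<open>These errors add up to \<open>\<kappa> / 2\<close>, so half of the bound
      remains.\<close>
    define \<eta> where "\<eta> k = \<kappa> / 4 * (1/2) ^ k" for k :: nat
    have \<eta>: "0 < \<eta> k" for k using \<kappa>(1) by (simp add: \<eta>_def)
    have "\<exists>\<rho>. diameter (V k) < \<rho> \<and> (ennreal (\<rho> powr t) \<le> hausdorff_gauge t (V k) + ennreal (\<eta> k) \<or> V k = {}) \<and> 0 < \<rho>" for k
      using gauge_enlarge[OF t_nonneg \<eta> V, of k k] by metis
    then obtain \<rho> where \<rho>: "\<And>k. diameter (V k) < \<rho> k" "\<And>k. 0 < \<rho> k"
      "\<And>k. ennreal (\<rho> k powr t) \<le> hausdorff_gauge t (V k) + ennreal (\<eta> k) \<or> V k = {}"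
      by metis
    have "limsup closed_core \<subseteq> (\<Union>k\<in>I. cube (y k) (\<rho> k))"
    proof
      fix z assume z: "z \<in> limsup closed_core"
      then obtain k where k: "vec_lambda z \<in> V k" using sub cov by blast
      then have kI: "k \<in> I" using z by (auto simp: I_def)
      have "dist (y k i) (z i) < \<rho> k" for i
      proof -
        have "dist (y k i) (z i) \<le> dist (vec_lambda (y k)) (vec_lambda z)"
          using dist_vec_nth_le[of "vec_lambda (y k)" i "vec_lambda z"] by simp
        also have "\<dots> \<le> diameter (V k)" by (rule diameter_bounded_bound[OF V y(2)[OF kI] k])
        finally show ?thesis using \<rho>(1)[of k] by simp
      qed
      then have "z \<in> cube (y k) (\<rho> k)"
        using z limsup_closed_core_subset by (auto simp: mem_box mem_space)
      then show "z \<in> (\<Union>k\<in>I. cube (y k) (\<rho> k))" using kI by blast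
    qed
    then obtain J where J: "J \<subseteq> I" "finite J" "\<kappa> \<le> (\<Sum>k\<in>J. \<rho> k powr t)"
      using \<kappa>(2)[of I y \<rho>] y(1) limsup_closed_core_subset \<rho>(2) by blast
    have "(\<Sum>k\<in>J. \<eta> k) \<le> (\<Sum>k. \<eta> k)"
      using \<eta> J(2) by (intro sum_le_suminf) (auto simp: \<eta>_def less_imp_le intro!: summable_mult summable_geometric)
    also have "\<dots> = \<kappa> / 2"
      unfolding \<eta>_def by (subst suminf_mult) (auto simp: suminf_geometric summable_geometric)
    finally have \<eta>_sum: "(\<Sum>k\<in>J. \<eta> k) \<le> \<kappa> / 2" .
    have "ennreal \<kappa> \<le> ennreal (\<Sum>k\<in>J. \<rho> k powr t)" using J(3) by (rule ennreal_leI)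
    also have "\<dots> = (\<Sum>k\<in>J. ennreal (\<rho> k powr t))" by (rule sum_ennreal[symmetric]) auto
    also have "\<dots> \<le> (\<Sum>k\<in>J. hausdorff_gauge t (V k) + ennreal (\<eta> k))"
      using \<rho>(3) J(1) y(2) by (intro sum_mono) blast
    also have "\<dots> = (\<Sum>k\<in>J. hausdorff_gauge t (V k)) + ennreal (\<Sum>k\<in>J. \<eta> k)"
      using \<eta> by (simp add: sum.distrib sum_ennreal less_imp_le)
    also have "\<dots> \<le> (\<Sum>k. hausdorff_gauge t (V k)) + ennreal (\<kappa> / 2)"
      using J(2) \<eta>_sum by (intro add_mono sum_le_suminf ennreal_leI) auto
    finally have "ennreal (\<kappa> / 2) + ennreal (\<kappa> / 2) \<le> ennreal (\<kappa> / 2) + (\<Sum>k. hausdorff_gauge t (V k))"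
      using \<kappa>(1) by (simp flip: ennreal_plus add: add.commute)
    then show ?thesis by (simp add: ennreal_add_left_cancel_le)
  qed
  \<comment> \<open>The estimate holds for covers by bounded sets of any size, so the single scale 1
    already bounds the supremum from below.\<close>
  then have "ennreal (\<kappa> / 2) \<le> hausdorff_premeasure 1 t (vec_lambda ` A :: ('a, 'p) vec set)"
    unfolding hausdorff_premeasure_def by (intro INF_greatest) auto
  also have "\<dots> \<le> hausdorff_measure t (vec_lambda ` A)"
    unfolding hausdorff_measure_def by (rule SUP_upper) simp
  finally show ?thesis using \<kappa>(1) by (auto simp: ennreal_eq_0_iff)
qed

subsection \<open>The mass transference principle\<close>

text \<open>With a nonpositive exponent the balls shrinking to a point would all keep mass at least
  \<open>a\<close>, and the point would be an atom.\<close>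

lemma ahlfors_regular_exponent_pos:
  assumes "ahlfors_regular \<delta> X \<mu>"
  shows "0 < \<delta>"
proof (rule ccontr)
  assume "\<not> 0 < \<delta>"
  obtain a r0 where a: "0 < a" and r0: "0 < r0"
    and low: "\<And>x r. x \<in> X \<Longrightarrow> 0 < r \<Longrightarrow> r \<le> r0 \<Longrightarrow> a * r powr \<delta> \<le> measure \<mu> (ball_in X x r)"
    and sets: "sets \<mu> = sets (restrict_space borel X)" and "prob_space \<mu>" and na: "nonatomic \<mu>"
    using assms unfolding ahlfors_regular_def by blast
  interpret prob_space \<mu> by fact
  have space: "space \<mu> = X"
    using sets_eq_imp_space_eq[OF sets] by (simp add: space_restrict_space)
  then obtain z where z: "z \<in> X" using not_empty by blast
  have point: "{z} \<in> sets \<mu>" unfolding sets sets_restrict_space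
    by (rule image_eqI[of _ _ "{z}"]) (use z in auto)
  define B where "B n = ball_in X z (1 / real (Suc n))" for n
  have B_sets: "B n \<in> sets \<mu>" for n
    unfolding B_def sets sets_restrict_space ball_in_def
    by (rule image_eqI[of _ _ "ball z (1 / real (Suc n))"]) (auto simp: Int_commute)
  have "(\<Inter>n. B n) = {z}"
  proof
    show "(\<Inter>n. B n) \<subseteq> {z}"
    proof
      fix w assume w: "w \<in> (\<Inter>n. B n)"
      have "dist z w = 0"
      proof (rule ccontr)
        assume "dist z w \<noteq> 0"
        then obtain n where "inverse (real (Suc n)) < dist z w"
          using reals_Archimedean[of "dist z w"] by auto
        then show False using w by (auto simp: B_def ball_in_def inverse_eq_divide dest!: spec[of _ n])
      qed
      then show "w \<in> {z}" by simp
    qed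
  qed (use z in \<open>auto simp: B_def ball_in_def\<close>)
  moreover have "decseq B"
    by (rule decseq_SucI) (auto simp: B_def ball_in_def frac_le elim!: less_le_trans)
  ultimately have lim: "(\<lambda>n. measure \<mu> (B n)) \<longlonglongrightarrow> measure \<mu> {z}"
    using finite_Lim_measure_decseq[of B] B_sets by auto
  obtain N where N: "1 / real (Suc N) < r0" using reals_Archimedean[OF r0] by (auto simp: inverse_eq_divide)
  have "a \<le> measure \<mu> (B n)" if "N \<le> n" for n
  proof -
    have "1 / real (Suc n) \<le> 1 / real (Suc N)" using that by (intro divide_left_mono) auto
    then have "a * (1 / real (Suc n)) powr \<delta> \<le> measure \<mu> (B n)"
      unfolding B_def using N z by (intro low) auto
    moreover have "(1 / real (Suc n)) powr 0 \<le> (1 / real (Suc n)) powr \<delta>"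
      using \<open>\<not> 0 < \<delta>\<close> by (intro powr_mono') auto
    then have "a * 1 \<le> a * (1 / real (Suc n)) powr \<delta>" using a by (intro mult_left_mono) auto
    ultimately show ?thesis by simp
  qed
  then have "a \<le> measure \<mu> {z}" by (intro LIMSEQ_le_const[OF lim]) blast
  then have "0 < emeasure \<mu> {z}" using a by (simp add: emeasure_eq_measure)
  then show False
    using na point unfolding nonatomic_def by (metis emeasure_empty subset_singleton_iff)
qed

lemma regular_product_of_ahlfors:
  fixes X :: "'p::finite \<Rightarrow> 'a::euclidean_space set"
  assumes "\<And>i. ahlfors_regular (\<delta> i) (X i) (\<mu> i)"
  obtains a b r0 where "regular_product X \<mu> \<delta> a b r0"
proof -
  have "\<exists>a b r0. 0 < a \<and> 1 \<le> b \<and> 0 < r0 \<and> (\<forall>x\<in>X i. \<forall>r. 0 < r \<and> r \<le> r0 \<longrightarrow>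
      a * r powr \<delta> i \<le> measure (\<mu> i) (ball_in (X i) x r) \<and>
      measure (\<mu> i) (ball_in (X i) x r) \<le> b * r powr \<delta> i)" for i
    using assms[of i] unfolding ahlfors_regular_def by blast
  then obtain a b r0 where ab: "\<And>i. 0 < a i" "\<And>i. 1 \<le> b i" "\<And>i. 0 < r0 i"
    "\<And>i x r. x \<in> X i \<Longrightarrow> 0 < r \<Longrightarrow> r \<le> r0 i \<Longrightarrow> a i * r powr \<delta> i \<le> measure (\<mu> i) (ball_in (X i) x r)"
    "\<And>i x r. x \<in> X i \<Longrightarrow> 0 < r \<Longrightarrow> r \<le> r0 i \<Longrightarrow> measure (\<mu> i) (ball_in (X i) x r) \<le> b i * r powr \<delta> i"
    by metis
  have "regular_product X \<mu> \<delta> (Min (range a)) (Max (range b)) (Min (range r0))"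
  proof (rule regular_product.intro)
    fix i y s
    show "sets (\<mu> i) = sets (restrict_space borel (X i))" "prob_space (\<mu> i)"
      using assms[of i] by (auto simp: ahlfors_regular_def)
    show "0 < \<delta> i" by (rule ahlfors_regular_exponent_pos[OF assms])
    show "0 < Min (range a)" "0 < Min (range r0)" using ab by auto
    have "b i \<le> Max (range b)" by (rule Max_ge) auto
    then show "0 < Max (range b)" using ab(2)[of i] by linarith
    assume y: "y \<in> X i" and s: "0 < s" "s \<le> Min (range r0)"
    have s': "s \<le> r0 i" using s(2) by simp
    have "Min (range a) * s powr \<delta> i \<le> a i * s powr \<delta> i" by (intro mult_right_mono Min_le) auto
    also have "\<dots> \<le> measure (\<mu> i) (ball_in (X i) y s)" using y s(1) s' by (rule ab(4))
    finally show "Min (range a) * s powr \<delta> i \<le> measure (\<mu> i) (ball_in (X i) y s)" .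
    have "measure (\<mu> i) (ball_in (X i) y s) \<le> b i * s powr \<delta> i" using y s(1) s' by (rule ab(5))
    also have "\<dots> \<le> Max (range b) * s powr \<delta> i" by (intro mult_right_mono Max_ge) auto
    finally show "measure (\<mu> i) (ball_in (X i) y s) \<le> Max (range b) * s powr \<delta> i" .
  qed
  then show ?thesis by (rule that)
qed

theorem theorem3:
  fixes d :: "'p::finite \<Rightarrow> nat"
    and V X :: "'p \<Rightarrow> 'a::euclidean_space set"
    and \<mu> :: "'p \<Rightarrow> 'a measure"
    and \<delta> u :: "'p \<Rightarrow> real"
    and v :: "'p \<Rightarrow> ereal"
    and x :: "'p \<Rightarrow> nat \<Rightarrow> 'a"
    and rad vn :: "'p \<Rightarrow> nat \<Rightarrow> real"
    and r :: "nat \<Rightarrow> real"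
  assumes "\<And>i. subspace (V i)" and "\<And>i. dim (V i) = d i" and "\<And>i. X i \<subseteq> V i"
    and "\<And>i. locally compact (X i)"
    and "\<And>i. ahlfors_regular (\<delta> i) (X i) (\<mu> i)"
    and "\<And>i n. x i n \<in> X i"
    and "\<And>i. rad i \<longlonglongrightarrow> 0"
    and "\<And>n. 0 < r n" and "\<And>i n. 0 < vn i n"
    and "\<And>i n. rad i n = r n powr vn i n"
    and "r \<longlonglongrightarrow> 0"
    and "\<And>i. 0 < v i"
    and "\<And>i. (\<lambda>n. ereal (vn i n)) \<longlonglongrightarrow> v i"
    and "\<And>i. 0 < u i" and "\<And>i. ereal (u i) \<le> v i"
    and "emeasure (PiM UNIV \<mu>)
           (limsup (\<lambda>n. PiE UNIV (\<lambda>i. scaled_ball (X i) (\<delta> i) (u i * \<delta> i / vn i n) (x i n) (rad i n))))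
         = emeasure (PiM UNIV \<mu>) (PiE UNIV X)"
  shows "hausdorff_dim
           (vec_lambda ` limsup (\<lambda>n. PiE UNIV (\<lambda>i. ball_in (X i) (x i n) (rad i n))) :: ('a, 'p) vec set)
         \<ge> ereal (dim_number \<delta> u v)"
  unfolding hausdorff_dim_def
proof (rule INF_greatest)
  note lc = assms(4) and regular = assms(5) and x_in = assms(6) and r_pos = assms(8) and vn_pos = assms(9)
    and rad = assms(10) and r_lim = assms(11) and vn_lim = assms(13) and u_pos = assms(14)
    and u_le = assms(15) and full_measure = assms(16)
  let ?A = "limsup (\<lambda>n. PiE UNIV (\<lambda>i. ball_in (X i) (x i n) (rad i n)))"
  fix t assume "t \<in> {s. 0 \<le> s \<and> hausdorff_measure s (vec_lambda ` ?A :: ('a, 'p) vec set) = 0}"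
  then have t: "0 \<le> t" "hausdorff_measure t (vec_lambda ` ?A :: ('a, 'p) vec set) = 0" by auto
  define s where "s = dim_number \<delta> u v"
  have "s \<le> t"
  proof (rule ccontr)
    assume "\<not> s \<le> t"
    then have ts: "t < s" by simp
    define t' where "t' = (t + s) / 2"
    have t': "t < t'" "t' < s" using ts by (auto simp: t'_def)
    obtain a b r0 where reg: "regular_product X \<mu> \<delta> a b r0"
      using regular_product_of_ahlfors[OF regular] .
    interpret regular_product X \<mu> \<delta> a b r0 by (rule reg)
    have \<Delta>: "0 < \<Delta>" using \<delta>_pos by (intro sum_pos) auto
    define L where "L = fin_idx v"
    \<comment> \<open>Chosen so that the loss \<open>\<epsilon> * \<Delta> * w\<close> in
      \<open>mass_exponent_stretch\<close> is exactly \<open>(s - t') * w\<close>.\<close>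
    define \<epsilon> where "\<epsilon> = (s - t') / \<Delta>"
    have \<epsilon>: "0 < \<epsilon>" "\<epsilon> * \<Delta> = s - t'" using t' \<Delta> by (auto simp: \<epsilon>_def)
    define W where "W k = (1 + \<epsilon>) * real_of_ereal (v k)" for k
    have exponent: "t' * w \<le> mass_exponent \<delta> u L W w" if w: "0 < w" for w
    proof -
      have "t' * w = s * w - \<epsilon> * \<Delta> * w" unfolding \<epsilon>(2) by (simp add: algebra_simps)
      also have "\<dots> \<le> mass_exponent \<delta> u L (\<lambda>k. real_of_ereal (v k)) w - \<epsilon> * \<Delta> * w"
        using dim_number_le_mass_exponent[of u v \<delta> w] u_pos u_le \<delta>_pos w by (simp add: s_def L_def)
      also have "\<dots> \<le> mass_exponent \<delta> u L W w"
        unfolding W_def using \<delta>_pos w \<epsilon>(1) by (intro mass_exponent_stretch) auto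
      finally show ?thesis .
    qed
    have v_fin: "v k = ereal (real_of_ereal (v k))" "u k \<le> real_of_ereal (v k)" if "k \<in> L" for k
      using that u_le[of k] by (cases "v k"; simp add: L_def fin_idx_def)+
    have W_gt: "real_of_ereal (v k) < W k" if "k \<in> L" for k
      using v_fin(2)[OF that] u_pos[of k] \<epsilon>(1) by (simp add: W_def algebra_simps)
    have vn_le: "eventually (\<lambda>n. \<forall>i\<in>L. vn i n \<le> W i) sequentially"
    proof (rule eventually_ball_finite)
      show "\<forall>i\<in>L. eventually (\<lambda>n. vn i n \<le> W i) sequentially"
      proof
        fix i assume i: "i \<in> L"
        have "v i < ereal (W i)" using v_fin(1)[OF i] W_gt[OF i] by (metis less_ereal.simps(1))
        then have "eventually (\<lambda>n. ereal (vn i n) < ereal (W i)) sequentially"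
          by (rule order_tendstoD(2)[OF vn_lim])
        then show "eventually (\<lambda>n. vn i n \<le> W i) sequentially" by eventually_elim simp
      qed
    qed simp
    define U where "U n i = r n powr u i" for n i
    \<comment> \<open>The minimum is taken because \<open>vn i n\<close> may be below
      \<open>u i\<close> for some \<open>n\<close>, so that the small ball is the wider one. Halving
      puts the closed core inside the open small ball and secures
      \<open>2 * e n i \<le> U n i\<close>.\<close>
    define e where "e n i = min (U n i) (rad i n) / 2" for n i
    have e_pos: "0 < e n i" for n i using r_pos[of n] by (simp add: e_def U_def rad)
    have scaled: "scaled_ball (X i) (\<delta> i) (u i * \<delta> i / vn i n) (x i n) (rad i n) = ball_in (X i) (x i n) (U n i)" for i n
      using \<delta>_pos[of i] vn_pos[of i n] by (simp add: scaled_ball_def U_def rad powr_powr)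
    \<comment> \<open>The value \<open>1/2\<close> for \<open>\<sigma>\<close> keeps
      \<open>\<rho>\<close> below 1, as \<open>rectangle_content_bound\<close> demands.\<close>
    interpret rectangle_family X \<mu> \<delta> a b r0 "\<lambda>n i. x i n" U e r t t' "2 powr \<Delta>" "1/2"
    proof
      show "(\<lambda>n. U n i) \<longlonglongrightarrow> 0" for i
        unfolding U_def using r_lim u_pos[of i] r_pos
        by (intro tendsto_zero_powrI[where b = "u i"]) (auto simp: less_imp_le)
      show "measure M (limsup (\<lambda>n. box (\<lambda>i. x i n) (U n))) = 1"
        using full_measure product.emeasure_space_1
        by (simp add: box_def scaled space_M measure_def)
      show "r m \<le> r n \<Longrightarrow> U m i \<le> U n i" for m n i
        unfolding U_def using r_pos[of m] u_pos[of i] by (intro powr_mono2) auto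
      have "eventually (\<lambda>n. r n < 1) sequentially" using r_lim by (rule order_tendstoD) simp
      then show "eventually (\<lambda>n. \<forall>\<rho>. 0 < \<rho> \<and> \<rho> \<le> 1/2 \<longrightarrow>
        (\<Prod>i\<in>UNIV. (max \<rho> (U n i) * min 1 (\<rho> / e n i)) powr \<delta> i) \<le> 2 powr \<Delta> * \<rho> powr t') sequentially"
        using vn_le
      proof eventually_elim
        case (elim n)
        show ?case
        proof (intro allI impI)
          fix \<rho> :: real assume \<rho>: "0 < \<rho> \<and> \<rho> \<le> 1/2"
          show "(\<Prod>i\<in>UNIV. (max \<rho> (U n i) * min 1 (\<rho> / e n i)) powr \<delta> i) \<le> 2 powr \<Delta> * \<rho> powr t'"
            unfolding U_def
          proof (rule rectangle_content_bound[where L = L and V = W])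
            fix i assume i: "i \<in> L"
            \<comment> \<open>For \<open>r n < 1\<close> larger exponents give smaller radii, and
              \<open>W i\<close> exceeds \<open>u i\<close> as well as, eventually,
              \<open>vn i n\<close>.\<close>
            have "r n powr W i \<le> U n i" "r n powr W i \<le> rad i n"
              unfolding U_def rad using elim i r_pos[of n] v_fin(2)[OF i] W_gt[OF i]
              by (auto intro!: powr_mono')
            then show "r n powr W i \<le> 2 * e n i" by (simp add: e_def)
          qed (use elim \<rho> r_pos \<delta>_pos e_pos exponent in auto)
        qed
      qed
    qed (use x_in e_pos t t' in \<open>auto simp: e_def\<close>)
    have "closed_core n \<subseteq> PiE UNIV (\<lambda>i. ball_in (X i) (x i n) (rad i n))" for n
    proof
      fix z assume z: "z \<in> closed_core n"
      have "dist (x i n) (z i) < rad i n" for i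
      proof -
        have "dist (x i n) (z i) \<le> e n i" using z by (simp add: closed_core_def)
        also have "\<dots> \<le> rad i n / 2" by (simp add: e_def)
        also have "\<dots> < rad i n" using r_pos[of n] by (simp add: rad)
        finally show ?thesis .
      qed
      then show "z \<in> PiE UNIV (\<lambda>i. ball_in (X i) (x i n) (rad i n))"
        using z by (simp add: closed_core_def ball_in_def PiE_iff)
    qed
    then have "limsup closed_core \<subseteq> ?A" by (intro Limsup_mono always_eventually allI)
    then show False using hausdorff_measure_pos[OF lc] t(2) by blast
  qed
  then show "ereal (dim_number \<delta> u v) \<le> ereal t" by (simp add: s_def)
qed

end
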